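(* Let $k$ be a field with $\mathrm{char}(k)\ne2$ and $G=C_2\times C_2=\{e,\sigma,\tau,\rho\}$. On $k[G]$ there are the following commutative and cocommutative weak braided Hopf algebra structures, in both cases with unit $e$, counit $\varepsilon(e)=4$, $\varepsilon(x)=0$ for $x\in\{\sigma,\tau,\rho\}$, and antipode the identity. (i) For any fixed $a\in k^*$, in the category ${\rm Vect}^G_g$, where $g(x,x)=a$ for $x\in\{\sigma,\tau,\rho\}$ and $g=1$ elsewhere. Multiplication: $e$ is the unit, $\sigma\bullet\sigma=\tau\bullet\tau=\rho\bullet\rho=a^{-1}e$, $\sigma\bullet\tau=\tau\bullet\sigma=\rho$, $\sigma\bullet\rho=\rho\bullet\sigma=\tau$, $\tau\bullet\rho=\rho\bullet\tau=\sigma$. Comultiplication: $$\begin{aligned}\Delta(e)&=\tfrac14(e\otimes e+a\,\sigma\otimes\sigma+a\,\tau\otimes\tau+a\,\rho\otimes\rho),\\ \Delta(\sigma)&=\tfrac14(e\otimes\sigma+\sigma\otimes e+\tau\otimes\rho+\rho\otimes\tau),\\ \Delta(\tau)&=\tfrac14(e\otimes\tau+\tau\otimes e+\sigma\otimes\rho+\rho\otimes\sigma),\\ \Delta(\rho)&=\tfrac14(e\otimes\rho+\rho\otimes e+\sigma\otimes\tau+\tau\otimes\sigma).\end{aligned}$$ (ii) For any $d\in k^*$, in the category ${\rm Vect}^G_g$, where $g(x,x)=d$ for $x\in\{\sigma,\tau,\rho\}$, $g(\tau,\sigma)=g(\sigma,\rho)=g(\rho,\tau)=d$ and $g=1$ elsewhere.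 Multiplication: $e$ is the unit, $\sigma\bullet\sigma=\tau\bullet\tau=\rho\bullet\rho=d^{-1}e$, $\sigma\bullet\tau=\rho$, $\sigma\bullet\rho=d^{-1}\tau$, $\tau\bullet\sigma=d^{-1}\rho$, $\tau\bullet\rho=\sigma$, $\rho\bullet\sigma=\tau$, $\rho\bullet\tau=d^{-1}\sigma$. Comultiplication: $$\begin{aligned}\Delta(e)&=\tfrac14(e\otimes e+d\,\sigma\otimes\sigma+d\,\tau\otimes\tau+d\,\rho\otimes\rho),\\ \Delta(\sigma)&=\tfrac14(e\otimes\sigma+\sigma\otimes e+\tau\otimes\rho+d\,\rho\otimes\tau),\\ \Delta(\tau)&=\tfrac14(e\otimes\tau+\tau\otimes e+d\,\sigma\otimes\rho+\rho\otimes\sigma),\\ \Delta(\rho)&=\tfrac14(e\otimes\rho+\rho\otimes e+\sigma\otimes\tau+d\,\tau\otimes\sigma).\end{aligned}$$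
   Context: $G=C_2\times C_2=\{e,\sigma,\tau,\rho\}$ is the Klein group, with $\sigma\tau=\tau\sigma=\rho$, $\sigma^2=\tau^2=e$. $k^*=k\setminus\{0\}$. ${\rm Vect}^G$ is the category of $G$-graded $k$-vector spaces and grading-preserving linear maps, with the usual graded tensor product and unit $k$ in degree $e$. $k[G]$ is graded by $|x|=x$ for $x\in G$. For $g:G\times G\to k^*$ with $g(e,x)=g(y,e)$ for all $x,y$, ${\rm Vect}^G_g$ is ${\rm Vect}^G$ with trivial unit constraints, associativity $(v\otimes w)\otimes z\mapsto\phi(|v|,|w|,|z|)\,v\otimes(w\otimes z)$, where $\phi(x,y,z)=g(y,z)g(xy,z)^{-1}g(x,yz)g(x,y)^{-1}$, and braiding $c(v\otimes w)=g(|v|,|w|)^{-1}g(|w|,|v|)\,w\otimes v$. This is a symmetric monoidal category. A weak braided Hopf algebra in a symmetric monoidal category (braiding $c$; associativity constraints inserted where needed) is an object $B$ that is an associative unital algebra $(B,m,\eta)$ and a coassociative counital coalgebra $(B,\Delta,\varepsilon)$ in the category, together with a morphism $S:B\to B$ (antipode), such that, writing $B$ also for ${\rm Id}_B$: (1) $\Delta m=(m\otimes m)(B\otimes c\otimes B)(\Delta\otimes\Delta)$; (2) $\varepsilon m(m\otimes B)=(\varepsilon m\otimes\varepsilon m)(B\otimes\Delta\otimes B)=(\varepsilon m\otimes\varepsilon m)(B\otimes c\Delta\otimes B)$; (3) $(\Delta\otimes B)\Delta\eta=(B\otimes m\otimes B)(\Delta\eta\otimes\Delta\eta)=(B\otimes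 mc\otimes B)(\Delta\eta\otimes\Delta\eta)$; (4) $m(B\otimes S)\Delta=(\varepsilon m\otimes B)(B\otimes c)(\Delta\eta\otimes B)$, $\ m(S\otimes B)\Delta=(B\otimes\varepsilon m)(c\otimes B)(B\otimes\Delta\eta)$, $\ m(m\otimes B)(S\otimes B\otimes S)(\Delta\otimes B)\Delta=S$. It is commutative if $mc=m$ and cocommutative if $c\Delta=\Delta$. Here $m(x\otimes y)=x\bullet y$, extended linearly. *)

theory Defs
  imports Complex_Main "HOL-Library.Poly_Mapping" "HOL-Library.FuncSet"
begin

record ('o, 'm) monoidal_data =
  Obj :: "'o set"
  Arr :: "'m set"
  Dom :: "'m \<Rightarrow> 'o"
  Cod :: "'m \<Rightarrow> 'o"
  Ident :: "'o \<Rightarrow> 'm" ("\<i>\<d>\<index>")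
  Comp :: "'m \<Rightarrow> 'm \<Rightarrow> 'm" (infixr "\<cdot>\<index>" 55)
  TensO :: "'o \<Rightarrow> 'o \<Rightarrow> 'o" (infixr "\<boxtimes>\<index>" 70)
  TensA :: "'m \<Rightarrow> 'm \<Rightarrow> 'm" (infixr "\<otimes>\<index>" 70)
  UnitO :: "'o" ("\<I>\<index>")
  Assoc :: "'o \<Rightarrow> 'o \<Rightarrow> 'o \<Rightarrow> 'm" ("\<a>\<index>")
  LUnit :: "'o \<Rightarrow> 'm" ("\<l>\<index>")
  RUnit :: "'o \<Rightarrow> 'm" ("\<r>\<index>")
  Braid :: "'o \<Rightarrow> 'o \<Rightarrow> 'm" ("\<c>\<index>")

definition Hom :: "('o, 'm, 'x) monoidal_data_scheme \<Rightarrow> 'o \<Rightarrow> 'o \<Rightarrow> 'm set" where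
  "Hom C A B = {f \<in> Arr C. Dom C f = A \<and> Cod C f = B}"

definition is_inverse :: "('o, 'm, 'x) monoidal_data_scheme \<Rightarrow> 'm \<Rightarrow> 'm \<Rightarrow> bool" where
  "is_inverse C f h \<longleftrightarrow> h \<in> Hom C (Cod C f) (Dom C f) \<and>
     Comp C h f = Ident C (Dom C f) \<and> Comp C f h = Ident C (Cod C f)"

definition is_iso :: "('o, 'm, 'x) monoidal_data_scheme \<Rightarrow> 'm \<Rightarrow> bool" where
  "is_iso C f \<longleftrightarrow> f \<in> Arr C \<and> (\<exists>h. is_inverse C f h)"

definition Inv :: "('o, 'm, 'x) monoidal_data_scheme \<Rightarrow> 'm \<Rightarrow> 'm" ("\<i>\<n>\<v>\<index>") where
  "Inv C f = (THE h. is_inverse C f h)"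

locale symmetric_monoidal_category =
  fixes C :: "('o, 'm, 'x) monoidal_data_scheme" (structure)
  assumes Dom_Obj: "f \<in> Arr C \<Longrightarrow> Dom C f \<in> Obj C"
    and Cod_Obj: "f \<in> Arr C \<Longrightarrow> Cod C f \<in> Obj C"
    and Ident_Hom: "A \<in> Obj C \<Longrightarrow> \<i>\<d> A \<in> Hom C A A"
    and Comp_Hom: "\<lbrakk>f \<in> Hom C A B; h \<in> Hom C B D\<rbrakk> \<Longrightarrow> h \<cdot> f \<in> Hom C A D"
    and Comp_Ident_left: "f \<in> Hom C A B \<Longrightarrow> \<i>\<d> B \<cdot> f = f"
    and Comp_Ident_right: "f \<in> Hom C A B \<Longrightarrow> f \<cdot> \<i>\<d> A = f"
    and Comp_assoc: "\<lbrakk>f \<in> Hom C A B; h \<in> Hom C B D; k \<in> Hom C D E\<rbrakk>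
          \<Longrightarrow> (k \<cdot> h) \<cdot> f = k \<cdot> (h \<cdot> f)"
    and UnitO_Obj: "\<I> \<in> Obj C"
    and TensO_Obj: "\<lbrakk>A \<in> Obj C; B \<in> Obj C\<rbrakk> \<Longrightarrow> A \<boxtimes> B \<in> Obj C"
    and TensA_Hom: "\<lbrakk>f \<in> Hom C A A'; h \<in> Hom C B B'\<rbrakk> \<Longrightarrow> f \<otimes> h \<in> Hom C (A \<boxtimes> B) (A' \<boxtimes> B')"
    and TensA_Ident: "\<lbrakk>A \<in> Obj C; B \<in> Obj C\<rbrakk> \<Longrightarrow> \<i>\<d> A \<otimes> \<i>\<d> B = \<i>\<d> (A \<boxtimes> B)"
    and TensA_Comp: "\<lbrakk>f \<in> Hom C A A'; f' \<in> Hom C A' A''; h \<in> Hom C B B'; h' \<in> Hom C B' B''\<rbrakk>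
          \<Longrightarrow> (f' \<cdot> f) \<otimes> (h' \<cdot> h) = (f' \<otimes> h') \<cdot> (f \<otimes> h)"
    and Assoc_Hom: "\<lbrakk>A \<in> Obj C; B \<in> Obj C; D \<in> Obj C\<rbrakk>
          \<Longrightarrow> \<a> A B D \<in> Hom C ((A \<boxtimes> B) \<boxtimes> D) (A \<boxtimes> (B \<boxtimes> D))"
    and Assoc_iso: "\<lbrakk>A \<in> Obj C; B \<in> Obj C; D \<in> Obj C\<rbrakk> \<Longrightarrow> is_iso C (\<a> A B D)"
    and Assoc_natural: "\<lbrakk>f \<in> Hom C A A'; h \<in> Hom C B B'; k \<in> Hom C D D'\<rbrakk>
          \<Longrightarrow> \<a> A' B' D' \<cdot> ((f \<otimes> h) \<otimes> k) = (f \<otimes> (h \<otimes> k)) \<cdot> \<a> A B D"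
    and LUnit_Hom: "A \<in> Obj C \<Longrightarrow> \<l> A \<in> Hom C (\<I> \<boxtimes> A) A"
    and LUnit_iso: "A \<in> Obj C \<Longrightarrow> is_iso C (\<l> A)"
    and LUnit_natural: "f \<in> Hom C A B \<Longrightarrow> \<l> B \<cdot> (\<i>\<d> \<I> \<otimes> f) = f \<cdot> \<l> A"
    and RUnit_Hom: "A \<in> Obj C \<Longrightarrow> \<r> A \<in> Hom C (A \<boxtimes> \<I>) A"
    and RUnit_iso: "A \<in> Obj C \<Longrightarrow> is_iso C (\<r> A)"
    and RUnit_natural: "f \<in> Hom C A B \<Longrightarrow> \<r> B \<cdot> (f \<otimes> \<i>\<d> \<I>) = f \<cdot> \<r> A"
    and Braid_Hom: "\<lbrakk>A \<in> Obj C; B \<in> Obj C\<rbrakk> \<Longrightarrow> \<c> A B \<in> Hom C (A \<boxtimes> B) (B \<boxtimes> A)"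
    and Braid_natural: "\<lbrakk>f \<in> Hom C A A'; h \<in> Hom C B B'\<rbrakk>
          \<Longrightarrow> \<c> A' B' \<cdot> (f \<otimes> h) = (h \<otimes> f) \<cdot> \<c> A B"
    and Braid_symmetric: "\<lbrakk>A \<in> Obj C; B \<in> Obj C\<rbrakk> \<Longrightarrow> \<c> B A \<cdot> \<c> A B = \<i>\<d> (A \<boxtimes> B)"
    and pentagon: "\<lbrakk>A \<in> Obj C; B \<in> Obj C; D \<in> Obj C; E \<in> Obj C\<rbrakk>
          \<Longrightarrow> \<a> A B (D \<boxtimes> E) \<cdot> \<a> (A \<boxtimes> B) D E
            = (\<i>\<d> A \<otimes> \<a> B D E) \<cdot> \<a> A (B \<boxtimes> D) E \<cdot> (\<a> A B D \<otimes> \<i>\<d> E)"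
    and triangle: "\<lbrakk>A \<in> Obj C; B \<in> Obj C\<rbrakk>
          \<Longrightarrow> (\<i>\<d> A \<otimes> \<l> B) \<cdot> \<a> A \<I> B = \<r> A \<otimes> \<i>\<d> B"
    and hexagon: "\<lbrakk>A \<in> Obj C; B \<in> Obj C; D \<in> Obj C\<rbrakk>
          \<Longrightarrow> \<a> B D A \<cdot> \<c> A (B \<boxtimes> D) \<cdot> \<a> A B D
            = (\<i>\<d> B \<otimes> \<c> A D) \<cdot> \<a> B A D \<cdot> (\<c> A B \<otimes> \<i>\<d> D)"

text \<open>
  Where an axiom is usually written without brackets, the associativity constraints
  and the unit constraints are inserted. In the axioms for the counit on products and
  for the comultiplication of the unit, \<open>B \<otimes> \<Delta> \<otimes> B\<close> and \<open>B \<otimes> m \<otimes> B\<close> are arrows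
  \<open>B \<otimes> (B \<otimes> B) \<rightarrow> (B \<otimes> B) \<otimes> (B \<otimes> B)\<close> and \<open>(B \<otimes> B) \<otimes> (B \<otimes> B) \<rightarrow> (B \<otimes> B) \<otimes> B\<close>.
\<close>

locale weak_braided_hopf_algebra = symmetric_monoidal_category C
  for C :: "('o, 'm, 'x) monoidal_data_scheme" (structure) +
  fixes B :: 'o and m \<eta> \<Delta> \<epsilon> S :: 'm
  assumes B_Obj: "B \<in> Obj C"
    and m_Hom: "m \<in> Hom C (B \<boxtimes> B) B"
    and \<eta>_Hom: "\<eta> \<in> Hom C \<I> B"
    and \<Delta>_Hom: "\<Delta> \<in> Hom C B (B \<boxtimes> B)"
    and \<epsilon>_Hom: "\<epsilon> \<in> Hom C B \<I>"
    and S_Hom: "S \<in> Hom C B B"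
    and m_assoc: "m \<cdot> (m \<otimes> \<i>\<d> B) = m \<cdot> (\<i>\<d> B \<otimes> m) \<cdot> \<a> B B B"
    and m_unit_left: "m \<cdot> (\<eta> \<otimes> \<i>\<d> B) = \<l> B"
    and m_unit_right: "m \<cdot> (\<i>\<d> B \<otimes> \<eta>) = \<r> B"
    and \<Delta>_coassoc: "\<a> B B B \<cdot> (\<Delta> \<otimes> \<i>\<d> B) \<cdot> \<Delta> = (\<i>\<d> B \<otimes> \<Delta>) \<cdot> \<Delta>"
    and \<Delta>_counit_left: "\<l> B \<cdot> (\<epsilon> \<otimes> \<i>\<d> B) \<cdot> \<Delta> = \<i>\<d> B"
    and \<Delta>_counit_right: "\<r> B \<cdot> (\<i>\<d> B \<otimes> \<epsilon>) \<cdot> \<Delta> = \<i>\<d> B"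
    and \<Delta>_m: "\<Delta> \<cdot> m =
          (m \<otimes> m) \<cdot> \<i>\<n>\<v> (\<a> B B (B \<boxtimes> B))
            \<cdot> (\<i>\<d> B \<otimes> (\<a> B B B \<cdot> (\<c> B B \<otimes> \<i>\<d> B) \<cdot> \<i>\<n>\<v> (\<a> B B B)))
            \<cdot> \<a> B B (B \<boxtimes> B) \<cdot> (\<Delta> \<otimes> \<Delta>)"
    and \<epsilon>_m: "\<epsilon> \<cdot> m \<cdot> (m \<otimes> \<i>\<d> B) =
          \<l> \<I> \<cdot> ((\<epsilon> \<cdot> m) \<otimes> (\<epsilon> \<cdot> m)) \<cdot> \<i>\<n>\<v> (\<a> B B (B \<boxtimes> B))
            \<cdot> (\<i>\<d> B \<otimes> (\<a> B B B \<cdot> (\<Delta> \<otimes> \<i>\<d> B))) \<cdot> \<a> B B B"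
    and \<epsilon>_m_braided: "\<epsilon> \<cdot> m \<cdot> (m \<otimes> \<i>\<d> B) =
          \<l> \<I> \<cdot> ((\<epsilon> \<cdot> m) \<otimes> (\<epsilon> \<cdot> m)) \<cdot> \<i>\<n>\<v> (\<a> B B (B \<boxtimes> B))
            \<cdot> (\<i>\<d> B \<otimes> (\<a> B B B \<cdot> ((\<c> B B \<cdot> \<Delta>) \<otimes> \<i>\<d> B))) \<cdot> \<a> B B B"
    and \<Delta>_\<eta>: "(\<Delta> \<otimes> \<i>\<d> B) \<cdot> \<Delta> \<cdot> \<eta> =
          \<i>\<n>\<v> (\<a> B B B) \<cdot> (\<i>\<d> B \<otimes> ((m \<otimes> \<i>\<d> B) \<cdot> \<i>\<n>\<v> (\<a> B B B)))
            \<cdot> \<a> B B (B \<boxtimes> B) \<cdot> ((\<Delta> \<cdot> \<eta>) \<otimes> (\<Delta> \<cdot> \<eta>)) \<cdot> \<i>\<n>\<v> (\<l> \<I>)"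
    and \<Delta>_\<eta>_braided: "(\<Delta> \<otimes> \<i>\<d> B) \<cdot> \<Delta> \<cdot> \<eta> =
          \<i>\<n>\<v> (\<a> B B B) \<cdot> (\<i>\<d> B \<otimes> (((m \<cdot> \<c> B B) \<otimes> \<i>\<d> B) \<cdot> \<i>\<n>\<v> (\<a> B B B)))
            \<cdot> \<a> B B (B \<boxtimes> B) \<cdot> ((\<Delta> \<cdot> \<eta>) \<otimes> (\<Delta> \<cdot> \<eta>)) \<cdot> \<i>\<n>\<v> (\<l> \<I>)"
    and antipode_right: "m \<cdot> (\<i>\<d> B \<otimes> S) \<cdot> \<Delta> =
          \<l> B \<cdot> ((\<epsilon> \<cdot> m) \<otimes> \<i>\<d> B) \<cdot> \<i>\<n>\<v> (\<a> B B B) \<cdot> (\<i>\<d> B \<otimes> \<c> B B)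
            \<cdot> \<a> B B B \<cdot> ((\<Delta> \<cdot> \<eta>) \<otimes> \<i>\<d> B) \<cdot> \<i>\<n>\<v> (\<l> B)"
    and antipode_left: "m \<cdot> (S \<otimes> \<i>\<d> B) \<cdot> \<Delta> =
          \<r> B \<cdot> (\<i>\<d> B \<otimes> (\<epsilon> \<cdot> m)) \<cdot> \<a> B B B \<cdot> (\<c> B B \<otimes> \<i>\<d> B)
            \<cdot> \<i>\<n>\<v> (\<a> B B B) \<cdot> (\<i>\<d> B \<otimes> (\<Delta> \<cdot> \<eta>)) \<cdot> \<i>\<n>\<v> (\<r> B)"
    and antipode_antipode:
          "m \<cdot> (m \<otimes> \<i>\<d> B) \<cdot> ((S \<otimes> \<i>\<d> B) \<otimes> S) \<cdot> (\<Delta> \<otimes> \<i>\<d> B) \<cdot> \<Delta> = S"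

definition commutative_in :: "('o, 'm, 'x) monoidal_data_scheme \<Rightarrow> 'o \<Rightarrow> 'm \<Rightarrow> bool" where
  "commutative_in C B m \<longleftrightarrow> Comp C m (Braid C B B) = m"

definition cocommutative_in :: "('o, 'm, 'x) monoidal_data_scheme \<Rightarrow> 'o \<Rightarrow> 'm \<Rightarrow> bool" where
  "cocommutative_in C B \<Delta> \<longleftrightarrow> Comp C (Braid C B B) \<Delta> = \<Delta>"

datatype klein = e | \<sigma> | \<tau> | \<rho>

lemma UNIV_klein: "UNIV = {e, \<sigma>, \<tau>, \<rho>}"
  using klein.exhaust by auto

instance klein :: finite
  by standard (simp add: UNIV_klein)

instantiation klein :: comm_monoid_mult
begin

definition one_klein :: klein where "one_klein = e"

fun times_klein :: "klein \<Rightarrow> klein \<Rightarrow> klein" where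
  "times_klein e x = x"
| "times_klein x e = x"
| "times_klein \<sigma> \<sigma> = e" | "times_klein \<sigma> \<tau> = \<rho>" | "times_klein \<sigma> \<rho> = \<tau>"
| "times_klein \<tau> \<sigma> = \<rho>" | "times_klein \<tau> \<tau> = e" | "times_klein \<tau> \<rho> = \<sigma>"
| "times_klein \<rho> \<sigma> = \<tau>" | "times_klein \<rho> \<tau> = \<sigma>" | "times_klein \<rho> \<rho> = e"

instance
proof
  fix x y z :: klein
  show "x * y * z = x * (y * z)" by (cases x; cases y; cases z; simp)
  show "x * y = y * x" by (cases x; cases y; simp)
  show "1 * x = x" by (simp add: one_klein_def)
qed

end

lemma klein_square: "x * x = (1 :: klein)"
  by (cases x) (simp_all add: one_klein_def)

text \<open>
  A category needs one type of objects that is closed under the tensor product.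
  Vector spaces are therefore subspaces of the free vector space on a set of
  indices closed under pairing. Up to isomorphism these are all vector spaces of
  dimension at most the cardinality of \<open>'b index\<close>, where \<open>'b\<close> is an arbitrary type.
\<close>

datatype 'b index = IUnit | IGrp klein | IGen 'b | IPair "'b index" "'b index"

type_synonym ('b, 'k) vec = "'b index \<Rightarrow>\<^sub>0 'k"

definition smul :: "'k \<Rightarrow> ('i \<Rightarrow>\<^sub>0 'k) \<Rightarrow> ('i \<Rightarrow>\<^sub>0 'k :: field)" (infixr "*\<^sub>k" 75) where
  "c *\<^sub>k v = Poly_Mapping.map ((*) c) v"

lemma lookup_smul [simp]: "Poly_Mapping.lookup (c *\<^sub>k v) i = c * Poly_Mapping.lookup v i"
  by (simp add: smul_def Poly_Mapping.map.rep_eq when_def)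

global_interpretation vec: vector_space "smul :: 'k :: field \<Rightarrow> ('i \<Rightarrow>\<^sub>0 'k) \<Rightarrow> ('i \<Rightarrow>\<^sub>0 'k)"
  by standard (rule poly_mapping_eqI; simp add: lookup_add algebra_simps)+

text \<open>
  For subspaces \<open>V\<close> and \<open>W\<close> the span of the vectors \<open>v \<odot> w\<close> with \<open>v \<in> V\<close> and
  \<open>w \<in> W\<close> is a tensor product of \<open>V\<close> and \<open>W\<close>.
\<close>

definition vtens :: "('b, 'k) vec \<Rightarrow> ('b, 'k) vec \<Rightarrow> ('b, 'k :: field) vec" (infixr "\<odot>" 80) where
  "v \<odot> w = (\<Sum>i\<in>Poly_Mapping.keys v. \<Sum>j\<in>Poly_Mapping.keys w.
     Poly_Mapping.single (IPair i j) (Poly_Mapping.lookup v i * Poly_Mapping.lookup w j))"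

text \<open>A grading is given by the family of its homogeneous components.\<close>

type_synonym ('b, 'k) gspace = "klein \<Rightarrow> ('b, 'k) vec set"

definition carrier :: "('b, 'k :: field) gspace \<Rightarrow> ('b, 'k) vec set" where
  "carrier V = {\<Sum>x\<in>UNIV. v x |v. \<forall>x. v x \<in> V x}"

definition graded_space :: "('b, 'k :: field) gspace \<Rightarrow> bool" where
  "graded_space V \<longleftrightarrow> (\<forall>x. vec.subspace (V x)) \<and>
     (\<forall>v. (\<forall>x. v x \<in> V x) \<and> (\<Sum>x\<in>UNIV. v x) = 0 \<longrightarrow> (\<forall>x. v x = 0))"

text \<open>Linear grading-preserving maps, with value \<open>undefined\<close> outside the carrier.\<close>

definition graded_linear ::
    "('b, 'k :: field) gspace \<Rightarrow> ('b, 'k) gspace \<Rightarrow> (('b, 'k) vec \<Rightarrow> ('b, 'k) vec) \<Rightarrow> bool" where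
  "graded_linear V W f \<longleftrightarrow> f \<in> extensional (carrier V) \<and>
     (\<forall>u\<in>carrier V. \<forall>v\<in>carrier V. f (u + v) = f u + f v) \<and>
     (\<forall>c. \<forall>v\<in>carrier V. f (c *\<^sub>k v) = c *\<^sub>k f v) \<and>
     (\<forall>x. f ` V x \<subseteq> W x)"

datatype ('o, 'v) arrow = Arrow (src: 'o) (ap: "'v \<Rightarrow> 'v") (tgt: 'o)

type_synonym ('b, 'k) gmap = "(('b, 'k) gspace, ('b, 'k) vec) arrow"

definition the_gmap ::
    "('b, 'k :: field) gspace \<Rightarrow> ('b, 'k) gspace \<Rightarrow> ((('b, 'k) vec \<Rightarrow> ('b, 'k) vec) \<Rightarrow> bool)
       \<Rightarrow> ('b, 'k) gmap" where
  "the_gmap V W P = Arrow V (THE f. graded_linear V W f \<and> P f) W"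

definition gtens :: "('b, 'k :: field) gspace \<Rightarrow> ('b, 'k) gspace \<Rightarrow> ('b, 'k) gspace" where
  "gtens V W z = vec.span {v \<odot> w |v w. \<exists>x y. x * y = z \<and> v \<in> V x \<and> w \<in> W y}"

definition unit_vec :: "('b, 'k :: field) vec" where
  "unit_vec = Poly_Mapping.single IUnit 1"

definition gunit :: "('b, 'k :: field) gspace" where
  "gunit x = (if x = e then vec.span {unit_vec} else {0})"

definition assoc_coeff :: "(klein \<Rightarrow> klein \<Rightarrow> 'k :: field) \<Rightarrow> klein \<Rightarrow> klein \<Rightarrow> klein \<Rightarrow> 'k" where
  "assoc_coeff g x y z = g y z * inverse (g (x * y) z) * g x (y * z) * inverse (g x y)"

text \<open>
  This is a symmetric monoidal category when \<open>g\<close> has non-zero values and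
  \<open>g e x = g y e\<close> for all \<open>x\<close> and \<open>y\<close>.
\<close>

definition VectG ::
    "(klein \<Rightarrow> klein \<Rightarrow> 'k :: field) \<Rightarrow> (('b, 'k) gspace, ('b, 'k) gmap) monoidal_data" where
  "VectG g = \<lparr>
     Obj = Collect graded_space,
     Arr = {Arrow V f W |V f W. graded_space V \<and> graded_space W \<and> graded_linear V W f},
     Dom = src,
     Cod = tgt,
     Ident = (\<lambda>V. Arrow V (restrict (\<lambda>v. v) (carrier V)) V),
     Comp = (\<lambda>h f. Arrow (src f) (compose (carrier (src f)) (ap h) (ap f)) (tgt h)),
     TensO = gtens,
     TensA = (\<lambda>f h. the_gmap (gtens (src f) (src h)) (gtens (tgt f) (tgt h))
       (\<lambda>k. \<forall>v\<in>carrier (src f). \<forall>w\<in>carrier (src h). k (v \<odot> w) = ap f v \<odot> ap h w)),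
     UnitO = gunit,
     Assoc = (\<lambda>V W Z. the_gmap (gtens (gtens V W) Z) (gtens V (gtens W Z))
       (\<lambda>k. \<forall>x y z. \<forall>v\<in>V x. \<forall>w\<in>W y. \<forall>u\<in>Z z.
          k ((v \<odot> w) \<odot> u) = assoc_coeff g x y z *\<^sub>k (v \<odot> (w \<odot> u)))),
     LUnit = (\<lambda>V. the_gmap (gtens gunit V) V (\<lambda>k. \<forall>v\<in>carrier V. k (unit_vec \<odot> v) = v)),
     RUnit = (\<lambda>V. the_gmap (gtens V gunit) V (\<lambda>k. \<forall>v\<in>carrier V. k (v \<odot> unit_vec) = v)),
     Braid = (\<lambda>V W. the_gmap (gtens V W) (gtens W V)
       (\<lambda>k. \<forall>x y. \<forall>v\<in>V x. \<forall>w\<in>W y.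
          k (v \<odot> w) = (inverse (g x y) * g y x) *\<^sub>k (w \<odot> v)))\<rparr>"

definition bas :: "klein \<Rightarrow> ('b, 'k :: field) vec" ("\<langle>_\<rangle>") where
  "\<langle>x\<rangle> = Poly_Mapping.single (IGrp x) 1"

definition kG :: "('b, 'k :: field) gspace" where
  "kG x = vec.span {\<langle>x\<rangle>}"

fun counit :: "klein \<Rightarrow> ('b, 'k :: field) vec" where
  "counit e = 4 *\<^sub>k unit_vec"
| "counit \<sigma> = 0" | "counit \<tau> = 0" | "counit \<rho> = 0"

definition g1 :: "'k \<Rightarrow> klein \<Rightarrow> klein \<Rightarrow> 'k :: field" where
  "g1 a x y = (if (x, y) \<in> {(\<sigma>, \<sigma>), (\<tau>, \<tau>), (\<rho>, \<rho>)} then a else 1)"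

fun mult1 :: "'k \<Rightarrow> klein \<Rightarrow> klein \<Rightarrow> ('b, 'k :: field) vec" where
  "mult1 a e x = \<langle>x\<rangle>"
| "mult1 a x e = \<langle>x\<rangle>"
| "mult1 a \<sigma> \<sigma> = inverse a *\<^sub>k \<langle>e\<rangle>" | "mult1 a \<sigma> \<tau> = \<langle>\<rho>\<rangle>" | "mult1 a \<sigma> \<rho> = \<langle>\<tau>\<rangle>"
| "mult1 a \<tau> \<sigma> = \<langle>\<rho>\<rangle>" | "mult1 a \<tau> \<tau> = inverse a *\<^sub>k \<langle>e\<rangle>" | "mult1 a \<tau> \<rho> = \<langle>\<sigma>\<rangle>"
| "mult1 a \<rho> \<sigma> = \<langle>\<tau>\<rangle>" | "mult1 a \<rho> \<tau> = \<langle>\<sigma>\<rangle>" | "mult1 a \<rho> \<rho> = inverse a *\<^sub>k \<langle>e\<rangle>"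

fun comult1 :: "'k \<Rightarrow> klein \<Rightarrow> ('b, 'k :: field) vec" where
  "comult1 a e = inverse 4 *\<^sub>k
     (\<langle>e\<rangle> \<odot> \<langle>e\<rangle> + a *\<^sub>k (\<langle>\<sigma>\<rangle> \<odot> \<langle>\<sigma>\<rangle>) + a *\<^sub>k (\<langle>\<tau>\<rangle> \<odot> \<langle>\<tau>\<rangle>) + a *\<^sub>k (\<langle>\<rho>\<rangle> \<odot> \<langle>\<rho>\<rangle>))"
| "comult1 a \<sigma> = inverse 4 *\<^sub>k
     (\<langle>e\<rangle> \<odot> \<langle>\<sigma>\<rangle> + \<langle>\<sigma>\<rangle> \<odot> \<langle>e\<rangle> + \<langle>\<tau>\<rangle> \<odot> \<langle>\<rho>\<rangle> + \<langle>\<rho>\<rangle> \<odot> \<langle>\<tau>\<rangle>)"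
| "comult1 a \<tau> = inverse 4 *\<^sub>k
     (\<langle>e\<rangle> \<odot> \<langle>\<tau>\<rangle> + \<langle>\<tau>\<rangle> \<odot> \<langle>e\<rangle> + \<langle>\<sigma>\<rangle> \<odot> \<langle>\<rho>\<rangle> + \<langle>\<rho>\<rangle> \<odot> \<langle>\<sigma>\<rangle>)"
| "comult1 a \<rho> = inverse 4 *\<^sub>k
     (\<langle>e\<rangle> \<odot> \<langle>\<rho>\<rangle> + \<langle>\<rho>\<rangle> \<odot> \<langle>e\<rangle> + \<langle>\<sigma>\<rangle> \<odot> \<langle>\<tau>\<rangle> + \<langle>\<tau>\<rangle> \<odot> \<langle>\<sigma>\<rangle>)"

definition g2 :: "'k \<Rightarrow> klein \<Rightarrow> klein \<Rightarrow> 'k :: field" where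
  "g2 d x y = (if (x, y) \<in> {(\<sigma>, \<sigma>), (\<tau>, \<tau>), (\<rho>, \<rho>), (\<tau>, \<sigma>), (\<sigma>, \<rho>), (\<rho>, \<tau>)} then d else 1)"

fun mult2 :: "'k \<Rightarrow> klein \<Rightarrow> klein \<Rightarrow> ('b, 'k :: field) vec" where
  "mult2 d e x = \<langle>x\<rangle>"
| "mult2 d x e = \<langle>x\<rangle>"
| "mult2 d \<sigma> \<sigma> = inverse d *\<^sub>k \<langle>e\<rangle>" | "mult2 d \<sigma> \<tau> = \<langle>\<rho>\<rangle>" | "mult2 d \<sigma> \<rho> = inverse d *\<^sub>k \<langle>\<tau>\<rangle>"
| "mult2 d \<tau> \<sigma> = inverse d *\<^sub>k \<langle>\<rho>\<rangle>" | "mult2 d \<tau> \<tau> = inverse d *\<^sub>k \<langle>e\<rangle>" | "mult2 d \<tau> \<rho> = \<langle>\<sigma>\<rangle>"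
| "mult2 d \<rho> \<sigma> = \<langle>\<tau>\<rangle>" | "mult2 d \<rho> \<tau> = inverse d *\<^sub>k \<langle>\<sigma>\<rangle>" | "mult2 d \<rho> \<rho> = inverse d *\<^sub>k \<langle>e\<rangle>"

fun comult2 :: "'k \<Rightarrow> klein \<Rightarrow> ('b, 'k :: field) vec" where
  "comult2 d e = inverse 4 *\<^sub>k
     (\<langle>e\<rangle> \<odot> \<langle>e\<rangle> + d *\<^sub>k (\<langle>\<sigma>\<rangle> \<odot> \<langle>\<sigma>\<rangle>) + d *\<^sub>k (\<langle>\<tau>\<rangle> \<odot> \<langle>\<tau>\<rangle>) + d *\<^sub>k (\<langle>\<rho>\<rangle> \<odot> \<langle>\<rho>\<rangle>))"
| "comult2 d \<sigma> = inverse 4 *\<^sub>k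
     (\<langle>e\<rangle> \<odot> \<langle>\<sigma>\<rangle> + \<langle>\<sigma>\<rangle> \<odot> \<langle>e\<rangle> + \<langle>\<tau>\<rangle> \<odot> \<langle>\<rho>\<rangle> + d *\<^sub>k (\<langle>\<rho>\<rangle> \<odot> \<langle>\<tau>\<rangle>))"
| "comult2 d \<tau> = inverse 4 *\<^sub>k
     (\<langle>e\<rangle> \<odot> \<langle>\<tau>\<rangle> + \<langle>\<tau>\<rangle> \<odot> \<langle>e\<rangle> + d *\<^sub>k (\<langle>\<sigma>\<rangle> \<odot> \<langle>\<rho>\<rangle>) + \<langle>\<rho>\<rangle> \<odot> \<langle>\<sigma>\<rangle>)"
| "comult2 d \<rho> = inverse 4 *\<^sub>k
     (\<langle>e\<rangle> \<odot> \<langle>\<rho>\<rangle> + \<langle>\<rho>\<rangle> \<odot> \<langle>e\<rangle> + \<langle>\<sigma>\<rangle> \<odot> \<langle>\<tau>\<rangle> + d *\<^sub>k (\<langle>\<tau>\<rangle> \<odot> \<langle>\<sigma>\<rangle>))"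

end

theory Submission
  imports Defs
begin

text \<open>
  Let \<open>g\<close> be a cochain as in the definition of \<open>VectG g\<close>, and for \<open>v\<close> of degree \<open>x\<close> and \<open>w\<close> of
  degree \<open>y\<close> put \<open>tw x y v w = g x y *\<^sub>k (v \<odot> w)\<close>. The associativity constraint of \<open>VectG g\<close> is the
  coboundary of \<open>g\<close> and its braiding is the quotient of \<open>g\<close> by its transpose. Written in terms of
  these twisted tensors, both lose their scalars: they become \<open>(v w) u \<mapsto> v (w u)\<close> and
  \<open>v w \<mapsto> w v\<close>, while the tensor product of two graded maps still acts factorwise. In other words,
  the identity functor together with multiplication by \<open>g\<close> is a monoidal isomorphism between graded
  vector spaces with trivial constraints and \<open>VectG g\<close>, up to the unit constraints, which contribute
  the values \<open>g e y\<close> and \<open>g x e\<close>; these agree by assumption. Every coherence law for \<open>VectG g\<close> thus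
  reduces to the trivial one on twisted tensors of homogeneous vectors, which gives
  \<open>symmetric_monoidal_VectG\<close>.

  In both parts of the theorem the multiplication is \<open>\<langle>x\<rangle> \<odot> \<langle>y\<rangle> \<mapsto> inverse (g x y) *\<^sub>k \<langle>x * y\<rangle>\<close>,
  and the coefficient of \<open>\<langle>u\<rangle> \<odot> \<langle>u * x\<rangle>\<close> in the comultiplication of \<open>\<langle>x\<rangle>\<close> is \<open>g u (u * x) / 4\<close>.
  On twisted tensors this is the group algebra with \<open>x y \<mapsto> x * y\<close> and \<open>x \<mapsto> (1/4) \<Sum>u. u (u * x)\<close>,
  and no trace of \<open>g\<close> is left. Its axioms are identities between sums over the group. Those with
  the counit hold because \<open>\<epsilon>\<close> is \<open>4\<close> times the coefficient of the neutral element: it selects one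
  summand and its factor cancels the weight \<open>1/4\<close>. The others hold after a translation of the summation
  variable, where a free summation contributes the factor \<open>4\<close>. This is
  \<open>weak_braided_hopf_algebra_kG\<close>, which covers all normalized \<open>g\<close> at once.

  The structure arrows of \<open>VectG g\<close> are defined by description from their values on tensors. That
  these descriptions denote anything is shown by extending all data to the ambient free vector
  space: bilinear maps on it factor through \<open>\<odot>\<close> (\<open>bilift_vtens\<close>), and the projections to the
  homogeneous components extend to it (\<open>graded_space_components\<close>). Hence a map with degree
  dependent scalars is the restriction of a linear map of the whole space. Uniqueness follows since
  tensors of homogeneous vectors span (\<open>generates_gtens\<close>, \<open>the_gmap_eq\<close>).
\<close>

section \<open>Linear maps on free vector spaces\<close>

abbreviation vlinear :: "(('i \<Rightarrow>\<^sub>0 'k) \<Rightarrow> ('j \<Rightarrow>\<^sub>0 'k :: field)) \<Rightarrow> bool" where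
  "vlinear \<equiv> Vector_Spaces.linear smul smul"

lemma vlinear_iff:
  "vlinear F \<longleftrightarrow> (\<forall>u v. F (u + v) = F u + F v) \<and> (\<forall>c v. F (c *\<^sub>k v) = c *\<^sub>k F v)"
  by (simp add: Vector_Spaces.linear_iff vec.vector_space_axioms)

lemma vlinear_add: "vlinear F \<Longrightarrow> F (u + v) = F u + F v"
  and vlinear_smul: "vlinear F \<Longrightarrow> F (c *\<^sub>k v) = c *\<^sub>k F v"
  by (simp_all add: vlinear_iff)

lemma vlinear_zero: "vlinear F \<Longrightarrow> F 0 = 0"
  using vlinear_smul[of F 0 0] by simp

lemma vlinear_sum: "vlinear F \<Longrightarrow> F (sum v A) = (\<Sum>i\<in>A. F (v i))"
  by (induction A rule: infinite_finite_induct) (simp_all add: vlinear_add vlinear_zero)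

lemma vlinear_id: "vlinear (\<lambda>v. v)"
  by (simp add: vlinear_iff)

lemma vlinear_compose: "vlinear F \<Longrightarrow> vlinear H \<Longrightarrow> vlinear (\<lambda>v. F (H v))"
  by (simp add: vlinear_iff)

lemma vlinear_compose_smul: "vlinear F \<Longrightarrow> vlinear (\<lambda>v. c *\<^sub>k F v)"
  by (simp add: vlinear_iff vec.scale_right_distrib vec.scale_left_commute)

lemma vlinear_compose_sum: "(\<And>i. i \<in> A \<Longrightarrow> vlinear (F i)) \<Longrightarrow> vlinear (\<lambda>v. \<Sum>i\<in>A. F i v)"
  by (simp add: vlinear_iff sum.distrib vec.scale_sum_right)

lemma vlinear_lookup_smul: "vlinear (\<lambda>v. Poly_Mapping.lookup v i *\<^sub>k w)"
  by (simp add: vlinear_iff lookup_add vec.scale_left_distrib)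

definition linear_extension :: "('i \<Rightarrow> ('j \<Rightarrow>\<^sub>0 'k)) \<Rightarrow> ('i \<Rightarrow>\<^sub>0 'k) \<Rightarrow> ('j \<Rightarrow>\<^sub>0 'k :: field)" where
  "linear_extension b v = (\<Sum>i\<in>Poly_Mapping.keys v. Poly_Mapping.lookup v i *\<^sub>k b i)"

lemma linear_extension_superset:
  assumes "finite A" "Poly_Mapping.keys v \<subseteq> A"
  shows "linear_extension b v = (\<Sum>i\<in>A. Poly_Mapping.lookup v i *\<^sub>k b i)"
  unfolding linear_extension_def using assms by (intro sum.mono_neutral_left) (auto simp: in_keys_iff)

lemma vlinear_linear_extension: "vlinear (linear_extension (b :: 'i \<Rightarrow> ('j \<Rightarrow>\<^sub>0 'k :: field)))"
  unfolding vlinear_iff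
proof (intro conjI allI)
  fix u v :: "'i \<Rightarrow>\<^sub>0 'k" and c :: 'k
  let ?A = "Poly_Mapping.keys u \<union> Poly_Mapping.keys v"
  have "linear_extension b w = (\<Sum>i\<in>?A. Poly_Mapping.lookup w i *\<^sub>k b i)"
    if "Poly_Mapping.keys w \<subseteq> ?A" for w
    using that by (intro linear_extension_superset) simp_all
  then show "linear_extension b (u + v) = linear_extension b u + linear_extension b v"
    using keys_add[of u v]
    by (simp add: lookup_add vec.scale_left_distrib sum.distrib)
  have "Poly_Mapping.keys (c *\<^sub>k v) \<subseteq> Poly_Mapping.keys v"
    by (auto simp: in_keys_iff)
  then have "linear_extension b (c *\<^sub>k v) = (\<Sum>i\<in>Poly_Mapping.keys v. Poly_Mapping.lookup (c *\<^sub>k v) i *\<^sub>k b i)"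
    by (intro linear_extension_superset) simp_all
  then show "linear_extension b (c *\<^sub>k v) = c *\<^sub>k linear_extension b v"
    by (simp add: linear_extension_def vec.scale_sum_right)
qed

lemma linear_extension_single [simp]: "linear_extension b (Poly_Mapping.single i c) = c *\<^sub>k b i"
  by (simp add: linear_extension_def)

lemma vlinear_linear_extension_family:
  assumes "\<And>i. vlinear (\<lambda>u. b u i)"
  shows "vlinear (\<lambda>u. linear_extension (b u) v)"
  unfolding linear_extension_def by (intro vlinear_compose_sum vlinear_compose_smul assms)

lemma basis_expansion:
  "v = (\<Sum>i\<in>Poly_Mapping.keys v. Poly_Mapping.lookup v i *\<^sub>k Poly_Mapping.single i 1)"
  by (rule poly_mapping_eqI)
    (auto simp: lookup_sum lookup_single when_def in_keys_iff if_distrib sum.delta cong: if_cong)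

section \<open>The tensor product of vectors\<close>

lemma lookup_vtens_IPair [simp]:
  "Poly_Mapping.lookup (v \<odot> w) (IPair i j) = Poly_Mapping.lookup v i * Poly_Mapping.lookup w j"
proof -
  have "Poly_Mapping.lookup (v \<odot> w) (IPair i j) =
      (\<Sum>i'\<in>Poly_Mapping.keys v. \<Sum>j'\<in>Poly_Mapping.keys w.
        (if i' = i then Poly_Mapping.lookup v i' else 0) * (if j' = j then Poly_Mapping.lookup w j' else 0))"
    unfolding vtens_def lookup_sum lookup_single
    by (intro sum.cong refl) (simp add: when_def)
  also have "\<dots> = Poly_Mapping.lookup v i * Poly_Mapping.lookup w j"
    by (auto simp: in_keys_iff simp flip: sum_product)
  finally show ?thesis .
qed

lemma lookup_vtens_other:
  "(\<And>i j. p \<noteq> IPair i j) \<Longrightarrow> Poly_Mapping.lookup (v \<odot> w) p = 0"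
  unfolding vtens_def lookup_sum lookup_single
  by (intro sum.neutral ballI) (metis when_def)

lemma lookup_vtens:
  "Poly_Mapping.lookup (v \<odot> w) p =
    (case p of IPair i j \<Rightarrow> Poly_Mapping.lookup v i * Poly_Mapping.lookup w j | _ \<Rightarrow> 0)"
  by (cases p) (simp_all add: lookup_vtens_other)

definition vbilinear ::
    "(('i \<Rightarrow>\<^sub>0 'k) \<Rightarrow> ('j \<Rightarrow>\<^sub>0 'k) \<Rightarrow> ('l \<Rightarrow>\<^sub>0 'k :: field)) \<Rightarrow> bool" where
  "vbilinear \<beta> \<longleftrightarrow> (\<forall>w. vlinear (\<lambda>v. \<beta> v w)) \<and> (\<forall>v. vlinear (\<beta> v))"

lemma vbilinear_vtens: "vbilinear (\<odot>)"
  unfolding vbilinear_def vlinear_iff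
  by (auto intro!: poly_mapping_eqI simp: lookup_vtens lookup_add algebra_simps split: index.splits)

lemma vlinear_vtens_left: "vlinear F \<Longrightarrow> vlinear (\<lambda>v. F v \<odot> w)"
  and vlinear_vtens_right: "vlinear F \<Longrightarrow> vlinear (\<lambda>v. w \<odot> F v)"
  using vbilinear_vtens vlinear_compose[of "\<lambda>v. v \<odot> w" F] vlinear_compose[of "\<lambda>v. w \<odot> v" F]
  by (auto simp: vbilinear_def)

lemma vtens_smul_left [simp]: "(c *\<^sub>k v) \<odot> w = c *\<^sub>k (v \<odot> w)"
  and vtens_smul_right [simp]: "v \<odot> (c *\<^sub>k w) = c *\<^sub>k (v \<odot> w)"
  and vtens_zero_left [simp]: "0 \<odot> w = 0"
  and vtens_zero_right [simp]: "v \<odot> 0 = 0"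
  and vtens_sum_left: "sum f A \<odot> w = (\<Sum>i\<in>A. f i \<odot> w)"
  and vtens_sum_right: "v \<odot> sum f A = (\<Sum>i\<in>A. v \<odot> f i)"
  using vlinear_vtens_left[OF vlinear_id, of w] vlinear_vtens_right[OF vlinear_id, of w]
    vlinear_vtens_right[OF vlinear_id, of v]
    vlinear_zero[of "\<lambda>v. v \<odot> w"] vlinear_sum[of "\<lambda>v. v \<odot> w" f A]
  by (simp_all add: vlinear_iff vlinear_zero vlinear_sum)

text \<open>
  The linear map through which a bilinear map factors. Basis vectors that are not pairs occur in
  no tensor, and their value is arbitrary.
\<close>

definition bilift ::
    "(('b, 'k) vec \<Rightarrow> ('b, 'k) vec \<Rightarrow> ('j \<Rightarrow>\<^sub>0 'k)) \<Rightarrow> ('b, 'k :: field) vec \<Rightarrow> ('j \<Rightarrow>\<^sub>0 'k)" where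
  "bilift \<beta> = linear_extension (\<lambda>p. case p of
     IPair i j \<Rightarrow> \<beta> (Poly_Mapping.single i 1) (Poly_Mapping.single j 1) | _ \<Rightarrow> 0)"

lemma vlinear_bilift: "vlinear (bilift \<beta>)"
  unfolding bilift_def by (rule vlinear_linear_extension)

lemma bilift_vtens:
  assumes "vbilinear \<beta>"
  shows "bilift \<beta> (v \<odot> w) = \<beta> v w"
proof -
  have l: "vlinear (\<lambda>v. \<beta> v w)" "vlinear (\<beta> v)" for v w
    using assms by (simp_all add: vbilinear_def)
  have "bilift \<beta> (v \<odot> w) = (\<Sum>i\<in>Poly_Mapping.keys v. \<Sum>j\<in>Poly_Mapping.keys w.
      (Poly_Mapping.lookup v i * Poly_Mapping.lookup w j) *\<^sub>k
        \<beta> (Poly_Mapping.single i 1) (Poly_Mapping.single j 1))"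
    unfolding vtens_def by (simp add: vlinear_sum vlinear_bilift) (simp add: bilift_def)
  also have "\<dots> = (\<Sum>i\<in>Poly_Mapping.keys v. Poly_Mapping.lookup v i *\<^sub>k \<beta> (Poly_Mapping.single i 1)
      (\<Sum>j\<in>Poly_Mapping.keys w. Poly_Mapping.lookup w j *\<^sub>k Poly_Mapping.single j 1))"
    by (simp add: vlinear_sum[OF l(2)] vlinear_smul[OF l(2)] vec.scale_sum_right)
  also have "\<dots> = \<beta> (\<Sum>i\<in>Poly_Mapping.keys v. Poly_Mapping.lookup v i *\<^sub>k Poly_Mapping.single i 1)
      (\<Sum>j\<in>Poly_Mapping.keys w. Poly_Mapping.lookup w j *\<^sub>k Poly_Mapping.single j 1)"
    by (simp add: vlinear_sum[OF l(1)] vlinear_smul[OF l(1)])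
  finally show ?thesis
    by (simp flip: basis_expansion)
qed

text \<open>This makes iterated lifts available, which handle maps out of triple tensor products.\<close>

lemma vlinear_bilift_family:
  assumes "\<And>v w. vlinear (\<lambda>u. \<beta> u v w)"
  shows "vlinear (\<lambda>u. bilift (\<beta> u) (p :: ('b, 'k :: field) vec))"
  unfolding bilift_def
proof (rule vlinear_linear_extension_family)
  fix i :: "'b index"
  show "vlinear (\<lambda>u. case i of
      IPair i j \<Rightarrow> \<beta> u (Poly_Mapping.single i 1) (Poly_Mapping.single j 1) | _ \<Rightarrow> 0)"
    using assms by (cases i) (simp_all add: vlinear_iff)
qed

lemma vbilinear_vtens_compose:
  "vlinear F \<Longrightarrow> vlinear H \<Longrightarrow> vbilinear (\<lambda>v w. F v \<odot> H w)"
  by (simp add: vbilinear_def vlinear_vtens_left vlinear_vtens_right)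

lemma vbilinear_smul: "vbilinear \<beta> \<Longrightarrow> vbilinear (\<lambda>v w. c *\<^sub>k \<beta> v w)"
  by (simp add: vbilinear_def vlinear_compose_smul)

lemma vbilinear_sum: "(\<And>i. i \<in> A \<Longrightarrow> vbilinear (\<beta> i)) \<Longrightarrow> vbilinear (\<lambda>v w. \<Sum>i\<in>A. \<beta> i v w)"
  by (simp add: vbilinear_def vlinear_compose_sum)

lemma vbilinear_swap: "vbilinear \<beta> \<Longrightarrow> vbilinear (\<lambda>v w. \<beta> w v)"
  by (simp add: vbilinear_def)

section \<open>Graded spaces\<close>

lemma graded_spaceD: "graded_space V \<Longrightarrow> vec.subspace (V x)"
  by (simp add: graded_space_def)

lemma homogeneous_carrier:
  assumes "graded_space V" "v \<in> V x"
  shows "v \<in> carrier V"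
proof -
  have "v = (\<Sum>y\<in>UNIV. if y = x then v else 0)" by simp
  moreover have "\<forall>y. (if y = x then v else 0) \<in> V y"
    using assms by (auto intro: vec.subspace_0 graded_spaceD)
  ultimately show ?thesis unfolding carrier_def by blast
qed

lemma subspace_carrier:
  assumes "graded_space V"
  shows "vec.subspace (carrier V)"
proof (rule vec.subspaceI)
  note sub = graded_spaceD[OF assms]
  show "0 \<in> carrier V"
    using assms by (intro homogeneous_carrier[of V _ e]) (auto intro: vec.subspace_0 sub)
  fix u v c assume "u \<in> carrier V" "v \<in> carrier V"
  then obtain u' v' where uv: "u = (\<Sum>x\<in>UNIV. u' x)" "\<forall>x. u' x \<in> V x"
      "v = (\<Sum>x\<in>UNIV. v' x)" "\<forall>x. v' x \<in> V x"
    unfolding carrier_def by blast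
  have "u + v = (\<Sum>x\<in>UNIV. u' x + v' x)" "\<forall>x. u' x + v' x \<in> V x"
    using uv sub by (auto simp: sum.distrib intro: vec.subspace_add)
  then show "u + v \<in> carrier V" unfolding carrier_def by blast
  have "c *\<^sub>k u = (\<Sum>x\<in>UNIV. c *\<^sub>k u' x)" "\<forall>x. c *\<^sub>k u' x \<in> V x"
    using uv sub by (auto simp: vec.scale_sum_right intro: vec.subspace_scale)
  then show "c *\<^sub>k u \<in> carrier V" unfolding carrier_def by blast
qed

text \<open>
  Composition with a projection extends a linear map on a subspace to the whole space. This spares
  any choice of bases.
\<close>

lemma linear_projection:
  assumes "vec.subspace (V :: ('i \<Rightarrow>\<^sub>0 'k :: field) set)"
  shows "\<exists>P. vlinear P \<and> (\<forall>v. P v \<in> V) \<and> (\<forall>v\<in>V. P v = v)"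
proof -
  interpret pair: vector_space_pair
      "smul :: 'k \<Rightarrow> ('i \<Rightarrow>\<^sub>0 'k) \<Rightarrow> ('i \<Rightarrow>\<^sub>0 'k)" "smul :: 'k \<Rightarrow> ('i \<Rightarrow>\<^sub>0 'k) \<Rightarrow> ('i \<Rightarrow>\<^sub>0 'k)"
    by unfold_locales
  show ?thesis
    using pair.linear_exists_left_inverse_on[OF vlinear_id assms] by (auto simp: inj_on_def)
qed

lemma graded_space_components:
  assumes "graded_space (V :: ('b, 'k :: field) gspace)"
  shows "\<exists>P. (\<forall>x. vlinear (P x)) \<and> (\<forall>x y. \<forall>v\<in>V y. P x v = (if x = y then v else 0))"
proof -
  note sub = graded_spaceD[OF assms]
  \<comment> \<open>a vector has only one decomposition into homogeneous vectors, so decomposing is linear\<close>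
  have uniq: "v = w" if "\<forall>x. v x \<in> V x" "\<forall>x. w x \<in> V x"
      "(\<Sum>x\<in>UNIV. v x) = (\<Sum>x\<in>UNIV. w x)" for v w
  proof -
    have "\<forall>x. v x - w x \<in> V x"
      using that sub by (auto intro: vec.subspace_diff)
    moreover have "(\<Sum>x\<in>UNIV. v x - w x) = 0"
      using that by (simp add: sum_subtractf)
    ultimately have "\<forall>x. v x - w x = 0"
      using assms unfolding graded_space_def by (metis (no_types, lifting))
    then show ?thesis by auto
  qed
  have "\<forall>v\<in>carrier V. \<exists>c. (\<forall>x. c x \<in> V x) \<and> (\<Sum>x\<in>UNIV. c x) = v"
    unfolding carrier_def by blast
  then obtain c where c: "\<And>v x. v \<in> carrier V \<Longrightarrow> c v x \<in> V x"
      "\<And>v. v \<in> carrier V \<Longrightarrow> (\<Sum>x\<in>UNIV. c v x) = v"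
    by metis
  obtain P where P: "vlinear P" "\<And>v. P v \<in> carrier V" "\<And>v. v \<in> carrier V \<Longrightarrow> P v = v"
    using linear_projection[OF subspace_carrier[OF assms]] by blast
  have c': "c (P v) x \<in> V x" "(\<Sum>x\<in>UNIV. c (P v) x) = P v" for v x
    using c P(2) by auto
  have add: "c (P (u + v)) = (\<lambda>x. c (P u) x + c (P v) x)" for u v
    using c' sub by (intro uniq)
      (auto simp: sum.distrib simp flip: vlinear_add[OF P(1)] intro: vec.subspace_add)
  have scale: "c (P (a *\<^sub>k v)) = (\<lambda>x. a *\<^sub>k c (P v) x)" for a v
    using c' sub by (intro uniq)
      (auto simp flip: vlinear_smul[OF P(1)] vec.scale_sum_right intro: vec.subspace_scale)
  have hom: "c (P v) = (\<lambda>x. if x = y then v else 0)" if "v \<in> V y" for v y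
    using c'[of v] that sub unfolding P(3)[OF homogeneous_carrier[OF assms that]]
    by (intro uniq) (auto intro: vec.subspace_0)
  have "vlinear (\<lambda>v. c (P v) x)" for x
    by (simp add: vlinear_iff add scale)
  then show ?thesis
    using hom by (intro exI[of _ "\<lambda>x v. c (P v) x"]) simp
qed

definition component :: "('b, 'k :: field) gspace \<Rightarrow> klein \<Rightarrow> ('b, 'k) vec \<Rightarrow> ('b, 'k) vec" where
  "component V = (SOME P. (\<forall>x. vlinear (P x)) \<and> (\<forall>x y. \<forall>v\<in>V y. P x v = (if x = y then v else 0)))"

lemma
  assumes "graded_space V"
  shows vlinear_component: "vlinear (component V x)"
    and component_homogeneous: "v \<in> V y \<Longrightarrow> component V x v = (if x = y then v else 0)"
  using someI_ex[OF graded_space_components[OF assms]] unfolding component_def by blast+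

text \<open>Conversely, degree projections make a sum of subspaces direct.\<close>

lemma graded_spaceI:
  assumes "\<And>x. vec.subspace (V x)" "\<And>x. vlinear (P x)"
    and "\<And>x y v. v \<in> V y \<Longrightarrow> P x v = (if x = y then v else 0)"
  shows "graded_space V"
  unfolding graded_space_def
proof (intro conjI allI impI)
  fix v x assume v: "(\<forall>x. v x \<in> V x) \<and> (\<Sum>x\<in>UNIV. v x) = 0"
  have "P x (\<Sum>y\<in>UNIV. v y) = (\<Sum>y\<in>UNIV. if x = y then v y else 0)"
    unfolding vlinear_sum[OF assms(2)] using v assms(3) by (intro sum.cong) auto
  then show "v x = 0"
    using v by (simp add: vlinear_zero[OF assms(2)])
qed (rule assms(1))

text \<open>
  Homogeneous spanning families. Arrows are compared on such families, which can be as large as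
  the space itself or as small as a basis.
\<close>

definition generates :: "(klein \<Rightarrow> ('b, 'k :: field) vec set) \<Rightarrow> ('b, 'k) gspace \<Rightarrow> bool" where
  "generates T V \<longleftrightarrow> (\<forall>x. V x = vec.span (T x))"

lemma generates_self: "graded_space V \<Longrightarrow> generates V V"
  unfolding generates_def by (metis graded_spaceD vec.span_eq_iff)

lemma generates_in: "generates T V \<Longrightarrow> v \<in> T x \<Longrightarrow> v \<in> V x"
  by (simp add: generates_def vec.span_base)

lemma graded_linear_extend:
  assumes "graded_space V" "graded_linear V W f"
  shows "\<exists>F. vlinear F \<and> (\<forall>v\<in>carrier V. F v = f v)"
proof -
  obtain P where P: "vlinear P" "\<And>v. P v \<in> carrier V" "\<And>v. v \<in> carrier V \<Longrightarrow> P v = v"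
    using linear_projection[OF subspace_carrier[OF assms(1)]] by blast
  then show ?thesis
    using assms(2) unfolding graded_linear_def
    by (intro exI[of _ "\<lambda>v. f (P v)"]) (simp add: vlinear_iff)
qed

lemma vlinear_eq_on_span:
  assumes "vlinear F" "vlinear H" "\<And>s. s \<in> T \<Longrightarrow> F s = H s" "v \<in> vec.span T"
  shows "F v = H v"
  using assms(4)
proof (induction rule: vec.span_induct_alt)
  case base
  then show ?case using assms by (simp add: vlinear_zero)
next
  case (step c s w)
  then show ?case using assms(3)
    by (simp add: vlinear_add[OF assms(1)] vlinear_smul[OF assms(1)]
      vlinear_add[OF assms(2)] vlinear_smul[OF assms(2)])
qed

lemma vlinear_image_span:
  assumes "vlinear F" "\<And>s. s \<in> T \<Longrightarrow> F s \<in> U" "vec.subspace U" "v \<in> vec.span T"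
  shows "F v \<in> U"
  using assms(4)
proof (induction rule: vec.span_induct_alt)
  case base
  then show ?case using assms by (simp add: vlinear_zero vec.subspace_0)
next
  case (step c s w)
  then show ?case using assms
    by (simp add: vlinear_add[OF assms(1)] vlinear_smul[OF assms(1)]
      vec.subspace_add vec.subspace_scale)
qed

lemma graded_linear_eqI:
  assumes "graded_space V" "generates T V" "graded_linear V W f" "graded_linear V W' h"
    and "\<And>x s. s \<in> T x \<Longrightarrow> f s = h s"
  shows "f = h"
proof (rule extensionalityI[of _ "carrier V"])
  show "f \<in> extensional (carrier V)" "h \<in> extensional (carrier V)"
    using assms unfolding graded_linear_def by auto
  obtain F H where F: "vlinear F" "\<And>v. v \<in> carrier V \<Longrightarrow> F v = f v"
      and H: "vlinear H" "\<And>v. v \<in> carrier V \<Longrightarrow> H v = h v"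
    using graded_linear_extend[OF assms(1)] assms(3,4) by metis
  fix v assume "v \<in> carrier V"
  then obtain w where w: "\<forall>x. w x \<in> V x" "v = (\<Sum>x\<in>UNIV. w x)"
    unfolding carrier_def by blast
  have eq: "F (w x) = H (w x)" for x
  proof (rule vlinear_eq_on_span[OF F(1) H(1)])
    show "w x \<in> vec.span (T x)" using assms(2) w(1) by (simp add: generates_def)
    fix s assume s: "s \<in> T x"
    then have "s \<in> carrier V"
      using homogeneous_carrier[OF assms(1) generates_in[OF assms(2)]] by blast
    then show "F s = H s" using F(2) H(2) assms(5)[OF s] by simp
  qed
  then have "F v = H v"
    by (simp only: w(2) vlinear_sum[OF F(1)] vlinear_sum[OF H(1)] eq)
  then show "f v = h v"
    using F H \<open>v \<in> carrier V\<close> by simp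
qed

lemma graded_linear_restrict:
  assumes "graded_space V" "graded_space W" "generates T V" "vlinear K"
    and "\<And>x s. s \<in> T x \<Longrightarrow> K s \<in> W x"
  shows "graded_linear V W (restrict K (carrier V))"
proof -
  have "K v \<in> W x" if "v \<in> V x" for v x
    using that assms by (intro vlinear_image_span[of K "T x" "W x" v])
      (auto simp: generates_def graded_spaceD)
  then show ?thesis
    unfolding graded_linear_def
    using subspace_carrier[OF assms(1)] homogeneous_carrier[OF assms(1)]
    by (auto simp: vlinear_add[OF assms(4)] vlinear_smul[OF assms(4)]
      vec.subspace_add vec.subspace_scale)
qed

text \<open>
  A map that is specified by its values on generators is well defined as soon as some
  linear map on the ambient free space takes these values.
\<close>

lemma the_gmap_eq:
  assumes "graded_space V" "graded_space W" "generates T V" "vlinear K"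
    and "\<And>x s. s \<in> T x \<Longrightarrow> K s \<in> W x"
    and "P (restrict K (carrier V))"
    and "\<And>f x s. graded_linear V W f \<Longrightarrow> P f \<Longrightarrow> s \<in> T x \<Longrightarrow> f s = K s"
  shows "the_gmap V W P = Arrow V (restrict K (carrier V)) W"
proof -
  have K: "graded_linear V W (restrict K (carrier V))"
    using assms by (intro graded_linear_restrict)
  have "(THE f. graded_linear V W f \<and> P f) = restrict K (carrier V)"
  proof (rule the_equality)
    fix f assume f: "graded_linear V W f \<and> P f"
    show "f = restrict K (carrier V)"
    proof (rule graded_linear_eqI[OF assms(1,3) conjunct1[OF f] K])
      show "f s = restrict K (carrier V) s" if "s \<in> T x" for x s
        using f assms(7)[of f] that homogeneous_carrier[OF assms(1) generates_in[OF assms(3) that]]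
        by simp
    qed
  qed (use K assms(6) in simp)
  then show ?thesis by (simp add: the_gmap_def)
qed

text \<open>Together with \<open>mult_ac\<close> these decide equations in an elementary abelian 2-group.\<close>

lemma klein_simps [simp]:
  "x * e = (x :: klein)" "x * x = (e :: klein)" "x * (x * y) = (y :: klein)"
  by (cases x; cases y; simp)+

lemma klein_mult_eq_iff: "x * y = z \<longleftrightarrow> y = x * (z :: klein)"
  by auto

lemma graded_space_gtens [simp]:
  fixes V W :: "('b, 'k :: field) gspace"
  assumes "graded_space V" "graded_space W"
  shows "graded_space (gtens V W)"
proof (rule graded_spaceI)
  \<comment> \<open>in degree \<open>z\<close> the factors have degrees \<open>x\<close> and \<open>x * z\<close>, as \<open>x\<close> is its own inverse\<close>
  let ?P = "\<lambda>z. bilift (\<lambda>v w. \<Sum>x\<in>UNIV. component V x v \<odot> component W (x * z) w)"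
  show "vec.subspace (gtens V W z)" for z by (simp add: gtens_def)
  show "vlinear (?P z)" for z by (rule vlinear_bilift)
  fix z y p assume p: "p \<in> gtens V W y"
  have bil: "vbilinear (\<lambda>v w. \<Sum>x\<in>UNIV. component V x v \<odot> component W (x * z) w)" for z
    using assms by (intro vbilinear_sum vbilinear_vtens_compose vlinear_component)
  have *: "?P z (v \<odot> w) = (if z = y then v \<odot> w else 0)"
    if "v \<in> V a" "w \<in> W b" "a * b = y" for v w a b
  proof -
    have "?P z (v \<odot> w) = (\<Sum>x\<in>UNIV. if x = a then if a * z = b then v \<odot> w else 0 else 0)"
      unfolding bilift_vtens[OF bil] using that assms
      by (intro sum.cong) (auto simp: component_homogeneous[of V] component_homogeneous[of W])
    moreover have "a * z = b \<longleftrightarrow> z = y"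
      using that(3) by (metis klein_simps(3))
    ultimately show ?thesis by simp
  qed
  show "?P z p = (if z = y then p else 0)"
  proof (cases "z = y")
    case True
    have "?P z p = p"
    proof (rule vlinear_eq_on_span[OF vlinear_bilift vlinear_id _ p[unfolded gtens_def]])
      fix s assume "s \<in> {v \<odot> w |v w. \<exists>a b. a * b = y \<and> v \<in> V a \<and> w \<in> W b}"
      then obtain v w a b where s: "s = v \<odot> w" "v \<in> V a" "w \<in> W b" "a * b = y"
        by blast
      show "?P z s = s" unfolding s(1) *[OF s(2-4)] by (simp only: True refl if_True)
    qed
    then show ?thesis by (simp only: True refl if_True)
  next
    case False
    have zero: "vlinear (\<lambda>_ :: ('b, 'k) vec. 0 :: ('b, 'k) vec)" by (simp add: vlinear_iff)
    have "?P z p = 0"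
    proof (rule vlinear_eq_on_span[OF vlinear_bilift zero _ p[unfolded gtens_def]])
      fix s assume "s \<in> {v \<odot> w |v w. \<exists>a b. a * b = y \<and> v \<in> V a \<and> w \<in> W b}"
      then obtain v w a b where s: "s = v \<odot> w" "v \<in> V a" "w \<in> W b" "a * b = y"
        by blast
      show "?P z s = 0" unfolding s(1) *[OF s(2-4)] by (simp only: False if_False)
    qed
    then show ?thesis by (simp only: False if_False)
  qed
qed

lemma vtens_in_gtens:
  "v \<in> V x \<Longrightarrow> w \<in> W y \<Longrightarrow> x * y = z \<Longrightarrow> v \<odot> w \<in> gtens V W z"
  unfolding gtens_def by (intro vec.span_base) blast

lemma vtens_carrier:
  assumes "graded_space V" "graded_space W" "v \<in> carrier V" "w \<in> carrier W"
  shows "v \<odot> w \<in> carrier (gtens V W)"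
proof -
  obtain v' w' where *: "\<forall>x. v' x \<in> V x" "v = (\<Sum>x\<in>UNIV. v' x)" "\<forall>x. w' x \<in> W x" "w = (\<Sum>x\<in>UNIV. w' x)"
    using assms unfolding carrier_def by blast
  show ?thesis
    unfolding *(2,4) vtens_sum_left vtens_sum_right using assms *(1,3)
    by (intro vec.subspace_sum subspace_carrier homogeneous_carrier[OF _ vtens_in_gtens]) auto
qed

lemma carrier_closed [simp]:
  assumes "graded_space V"
  shows "u \<in> carrier V \<Longrightarrow> c *\<^sub>k u \<in> carrier V"
    and "(\<And>i. i \<in> A \<Longrightarrow> f i \<in> carrier V) \<Longrightarrow> sum f A \<in> carrier V"
  using subspace_carrier[OF assms] by (auto intro: vec.subspace_scale vec.subspace_sum)

lemma homogeneous_closed [simp]: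
  assumes "graded_space V"
  shows "u \<in> V x \<Longrightarrow> c *\<^sub>k u \<in> V x"
    and "(\<And>i. i \<in> A \<Longrightarrow> f i \<in> V x) \<Longrightarrow> sum f A \<in> V x"
  using graded_spaceD[OF assms] by (auto intro: vec.subspace_scale vec.subspace_sum)

lemma generates_gunit: "generates (\<lambda>x. if x = e then {unit_vec} else {}) gunit"
  by (simp add: generates_def gunit_def)

lemma graded_space_gunit [simp]: "graded_space gunit"
  by (rule graded_spaceI[of _ "\<lambda>x v. if x = e then v else 0"])
    (auto simp: gunit_def vlinear_iff split: if_splits)

lemma unit_vec_in [simp]: "unit_vec \<in> gunit e"
  by (simp add: gunit_def vec.span_base)

lemma unit_vec_carrier [simp]: "unit_vec \<in> carrier gunit"
  by (rule homogeneous_carrier[of _ _ e]) simp_all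

text \<open>
  The linear maps of the whole space that induce the constraints and their inverses. The scalars
  depend on degrees, so the vectors are first split into their components.
\<close>

lemma ex_reassociation:
  assumes "graded_space V" "graded_space W" "graded_space Z"
  shows "\<exists>K. vlinear K \<and> (\<forall>x y z. \<forall>v\<in>V x. \<forall>w\<in>W y. \<forall>u\<in>Z z.
    K ((v \<odot> w) \<odot> u) = c x y z *\<^sub>k (v \<odot> (w \<odot> u)))"
proof -
  let ?t = "\<lambda>v w u. \<Sum>x\<in>UNIV. \<Sum>y\<in>UNIV. \<Sum>z\<in>UNIV.
    c x y z *\<^sub>k (component V x v \<odot> (component W y w \<odot> component Z z u))"
  let ?K = "bilift (\<lambda>p u. bilift (\<lambda>v w. ?t v w u) p)"
  note comp = assms[THEN vlinear_component]
  have inner: "vbilinear (\<lambda>v w. ?t v w u)" for u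
    by (intro vbilinear_sum vbilinear_smul vbilinear_vtens_compose vlinear_vtens_left comp)
  have "vlinear (?t v w)" for v w
    by (intro vlinear_compose_sum vlinear_compose_smul vlinear_vtens_right comp)
  then have outer: "vbilinear (\<lambda>p u. bilift (\<lambda>v w. ?t v w u) p)"
    unfolding vbilinear_def by (intro conjI allI vlinear_bilift vlinear_bilift_family)
  have "?t v w u = c a b d *\<^sub>k (v \<odot> (w \<odot> u))"
    if "v \<in> V a" "w \<in> W b" "u \<in> Z d" for v w u a b d
  proof -
    have "?t v w u = (\<Sum>x\<in>UNIV. \<Sum>y\<in>UNIV. \<Sum>z\<in>UNIV.
        if z = d then if y = b then if x = a then c x y z *\<^sub>k (v \<odot> (w \<odot> u)) else 0 else 0 else 0)"
      using that by (intro sum.cong) (simp_all add: component_homogeneous[OF assms(1)]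
        component_homogeneous[OF assms(2)] component_homogeneous[OF assms(3)])
    then show ?thesis by simp
  qed
  then show ?thesis
    by (intro exI[of _ ?K]) (simp add: vlinear_bilift bilift_vtens[OF outer] bilift_vtens[OF inner])
qed

lemma ex_inverse_reassociation:
  assumes "graded_space V" "graded_space W" "graded_space Z"
  shows "\<exists>K. vlinear K \<and> (\<forall>x y z. \<forall>v\<in>V x. \<forall>w\<in>W y. \<forall>u\<in>Z z.
    K (v \<odot> (w \<odot> u)) = c x y z *\<^sub>k ((v \<odot> w) \<odot> u))"
proof -
  let ?t = "\<lambda>v w u. \<Sum>x\<in>UNIV. \<Sum>y\<in>UNIV. \<Sum>z\<in>UNIV.
    c x y z *\<^sub>k ((component V x v \<odot> component W y w) \<odot> component Z z u)"
  let ?K = "bilift (\<lambda>v p. bilift (\<lambda>w u. ?t v w u) p)"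
  note comp = assms[THEN vlinear_component]
  have inner: "vbilinear (?t v)" for v
    by (intro vbilinear_sum vbilinear_smul vbilinear_vtens_compose vlinear_vtens_right comp)
  have "vlinear (\<lambda>v. ?t v w u)" for w u
    by (intro vlinear_compose_sum vlinear_compose_smul vlinear_vtens_left comp)
  then have outer: "vbilinear (\<lambda>v p. bilift (\<lambda>w u. ?t v w u) p)"
    unfolding vbilinear_def by (intro conjI allI vlinear_bilift vlinear_bilift_family)
  have "?t v w u = c a b d *\<^sub>k ((v \<odot> w) \<odot> u)"
    if "v \<in> V a" "w \<in> W b" "u \<in> Z d" for v w u a b d
  proof -
    have "?t v w u = (\<Sum>x\<in>UNIV. \<Sum>y\<in>UNIV. \<Sum>z\<in>UNIV.
        if z = d then if y = b then if x = a then c x y z *\<^sub>k ((v \<odot> w) \<odot> u) else 0 else 0 else 0)"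
      using that by (intro sum.cong) (simp_all add: component_homogeneous[OF assms(1)]
        component_homogeneous[OF assms(2)] component_homogeneous[OF assms(3)])
    then show ?thesis by simp
  qed
  then show ?thesis
    by (intro exI[of _ ?K]) (simp add: vlinear_bilift bilift_vtens[OF outer] bilift_vtens[OF inner])
qed

lemma ex_exchange:
  assumes "graded_space V" "graded_space W"
  shows "\<exists>K. vlinear K \<and> (\<forall>x y. \<forall>v\<in>V x. \<forall>w\<in>W y. K (v \<odot> w) = c x y *\<^sub>k (w \<odot> v))"
proof -
  let ?t = "\<lambda>v w. \<Sum>x\<in>UNIV. \<Sum>y\<in>UNIV. c x y *\<^sub>k (component W y w \<odot> component V x v)"
  note comp = assms[THEN vlinear_component]
  have bil: "vbilinear ?t"
    by (intro vbilinear_sum vbilinear_smul vbilinear_swap[OF vbilinear_vtens_compose] comp)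
  have "?t v w = c a b *\<^sub>k (w \<odot> v)" if "v \<in> V a" "w \<in> W b" for v w a b
  proof -
    have "?t v w = (\<Sum>x\<in>UNIV. \<Sum>y\<in>UNIV.
        if y = b then if x = a then c x y *\<^sub>k (w \<odot> v) else 0 else 0)"
      using that by (intro sum.cong) (simp_all add: component_homogeneous[OF assms(1)]
        component_homogeneous[OF assms(2)])
    then show ?thesis by simp
  qed
  then show ?thesis
    by (intro exI[of _ "bilift ?t"]) (simp add: vlinear_bilift bilift_vtens[OF bil])
qed

section \<open>Twisted tensors\<close>

locale klein_cochain =
  fixes g :: "klein \<Rightarrow> klein \<Rightarrow> 'k :: field"
  assumes g_nonzero [simp]: "g x y \<noteq> 0"
    and g_unit: "g e x = g y e"
begin

text \<open>
  The degrees are arguments because the zero vector is homogeneous of every degree.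
\<close>

definition tw :: "klein \<Rightarrow> klein \<Rightarrow> ('b, 'k) vec \<Rightarrow> ('b, 'k) vec \<Rightarrow> ('b, 'k) vec" where
  "tw x y v w = g x y *\<^sub>k (v \<odot> w)"

lemma tw_smul_left [simp]: "tw x y (c *\<^sub>k v) w = c *\<^sub>k tw x y v w"
  and tw_smul_right [simp]: "tw x y v (c *\<^sub>k w) = c *\<^sub>k tw x y v w"
  and tw_zero_left [simp]: "tw x y 0 w = 0"
  and tw_zero_right [simp]: "tw x y v 0 = 0"
  and tw_sum_left [simp]: "tw x y (sum f A) w = (\<Sum>i\<in>A. tw x y (f i) w)"
  and tw_sum_right [simp]: "tw x y v (sum f A) = (\<Sum>i\<in>A. tw x y v (f i))"
  by (simp_all add: tw_def vtens_sum_left vtens_sum_right vec.scale_sum_right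
    vec.scale_left_commute)

definition tw_set ::
    "(klein \<Rightarrow> ('b, 'k) vec set) \<Rightarrow> (klein \<Rightarrow> ('b, 'k) vec set) \<Rightarrow> klein \<Rightarrow> ('b, 'k) vec set" where
  "tw_set S T z = {tw x y s t |x y s t. x * y = z \<and> s \<in> S x \<and> t \<in> T y}"

lemma generates_gtens:
  assumes "generates S V" "generates T W"
  shows "generates (tw_set S T) (gtens V W)"
  unfolding generates_def
proof (intro allI antisym)
  fix z
  show "gtens V W z \<subseteq> vec.span (tw_set S T z)"
    unfolding gtens_def
  proof (rule vec.span_minimal)
    show "{v \<odot> w |v w. \<exists>x y. x * y = z \<and> v \<in> V x \<and> w \<in> W y} \<subseteq> vec.span (tw_set S T z)"
    proof clarify
      fix v w x y assume *: "z = x * y" "v \<in> V x" "w \<in> W y"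
      have st: "s \<odot> t \<in> vec.span (tw_set S T (x * y))" if "s \<in> S x" "t \<in> T y" for s t
      proof -
        have "s \<odot> t = inverse (g x y) *\<^sub>k tw x y s t" by (simp add: tw_def)
        moreover have "tw x y s t \<in> vec.span (tw_set S T (x * y))"
          using that unfolding tw_set_def by (intro vec.span_base) blast
        ultimately show ?thesis by (simp add: vec.span_scale)
      qed
      have sw: "s \<odot> w \<in> vec.span (tw_set S T (x * y))" if "s \<in> S x" for s
      proof (rule vlinear_image_span[OF vlinear_vtens_right[OF vlinear_id], where T = "T y"])
        show "w \<in> vec.span (T y)" using *(3) assms(2) by (simp add: generates_def)
      qed (use st[OF that] in simp_all)
      show "v \<odot> w \<in> vec.span (tw_set S T (x * y))"
      proof (rule vlinear_image_span[OF vlinear_vtens_left[OF vlinear_id], where T = "S x"])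
        show "v \<in> vec.span (S x)" using *(2) assms(1) by (simp add: generates_def)
      qed (use sw in simp_all)
    qed
  qed simp
  have "tw x y s t \<in> gtens V W (x * y)" if "s \<in> S x" "t \<in> T y" for x y s t
    using that generates_in[OF assms(1)] generates_in[OF assms(2)]
    by (auto simp: tw_def gtens_def intro!: vec.span_scale vtens_in_gtens[unfolded gtens_def])
  then show "vec.span (tw_set S T z) \<subseteq> gtens V W z"
    by (intro vec.span_minimal) (auto simp: tw_set_def gtens_def)
qed

lemma tw_in_gtens [simp]:
  "v \<in> V x \<Longrightarrow> w \<in> W y \<Longrightarrow> x * y = z \<Longrightarrow> tw x y v w \<in> gtens V W z"
  unfolding tw_def gtens_def by (intro vec.span_scale vec.span_base) blast

lemma tw_carrier [simp]:
  "graded_space V \<Longrightarrow> graded_space W \<Longrightarrow> v \<in> carrier V \<Longrightarrow> w \<in> carrier W \<Longrightarrow>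
    tw x y v w \<in> carrier (gtens V W)"
  by (simp add: tw_def vtens_carrier vec.subspace_scale subspace_carrier)

section \<open>Arrows of the category\<close>

lemma VectG_simps [simp]:
  "Obj (VectG g) = Collect graded_space" "Dom (VectG g) = src" "Cod (VectG g) = tgt"
  "TensO (VectG g) = gtens" "UnitO (VectG g) = gunit"
  by (simp_all add: VectG_def)

lemma in_Arr_iff:
  "f \<in> Arr (VectG g) \<longleftrightarrow>
    graded_space (src f) \<and> graded_space (tgt f) \<and> graded_linear (src f) (tgt f) (ap f)"
  by (cases f) (auto simp: VectG_def)

lemma in_Hom_iff:
  "f \<in> Hom (VectG g) V W \<longleftrightarrow>
    f \<in> Arr (VectG g) \<and> src f = V \<and> tgt f = W \<and> graded_space V \<and> graded_space W"
  by (auto simp: Hom_def in_Arr_iff)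

lemma Arr_graded [simp]:
  "f \<in> Arr (VectG g) \<Longrightarrow> graded_space (src f)"
  "f \<in> Arr (VectG g) \<Longrightarrow> graded_space (tgt f)"
  unfolding in_Arr_iff by simp_all

lemma ap_in [simp]:
  "f \<in> Arr (VectG g) \<Longrightarrow> tgt f = W \<Longrightarrow> v \<in> src f x \<Longrightarrow> ap f v \<in> W x"
  unfolding in_Arr_iff graded_linear_def by blast

lemma
  assumes "f \<in> Arr (VectG g)"
  shows ap_add: "u \<in> carrier (src f) \<Longrightarrow> v \<in> carrier (src f) \<Longrightarrow> ap f (u + v) = ap f u + ap f v"
    and ap_smul [simp]: "u \<in> carrier (src f) \<Longrightarrow> ap f (c *\<^sub>k u) = c *\<^sub>k ap f u"
  using assms unfolding in_Arr_iff graded_linear_def by blast+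

lemma ap_zero [simp]: "f \<in> Arr (VectG g) \<Longrightarrow> ap f 0 = 0"
  using ap_smul[of f 0 0] vec.subspace_0[OF subspace_carrier[of "src f"]] by simp

lemma ap_sum [simp]:
  assumes "f \<in> Arr (VectG g)" "\<And>i. i \<in> A \<Longrightarrow> v i \<in> carrier (src f)"
  shows "ap f (sum v A) = (\<Sum>i\<in>A. ap f (v i))"
  using assms(2)
  by (induction A rule: infinite_finite_induct) (simp_all add: assms(1) ap_add)

lemma ap_carrier [simp]:
  assumes "f \<in> Arr (VectG g)" "tgt f = W" "v \<in> carrier (src f)"
  shows "ap f v \<in> carrier W"
proof -
  obtain w where w: "\<forall>x. w x \<in> src f x" "v = (\<Sum>x\<in>UNIV. w x)"
    using assms(3) unfolding carrier_def by blast
  have "ap f v = (\<Sum>x\<in>UNIV. ap f (w x))"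
    unfolding w(2) using assms(1) w(1) homogeneous_carrier[of "src f"] by (intro ap_sum) auto
  moreover have "\<forall>x. ap f (w x) \<in> W x" using w(1) assms by auto
  ultimately show ?thesis unfolding carrier_def by blast
qed

lemma arrow_eqI:
  assumes "f \<in> Arr (VectG g)" "h \<in> Arr (VectG g)" "src f = V" "src h = V" "tgt f = tgt h"
    and "generates T V" "\<And>x s. s \<in> T x \<Longrightarrow> ap f s = ap h s"
  shows "f = h"
proof (rule arrow.expand, intro conjI)
  have "graded_space V" "graded_linear V (tgt f) (ap f)" "graded_linear V (tgt h) (ap h)"
    using assms(1-4) unfolding in_Arr_iff by auto
  from graded_linear_eqI[OF this(1) assms(6) this(2,3) assms(7)] show "ap f = ap h" .
qed (use assms(3-5) in simp_all)

lemma the_gmap_arrow: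
  assumes "graded_space V" "graded_space W" "generates T V" "vlinear K"
    and "\<And>x s. s \<in> T x \<Longrightarrow> K s \<in> W x"
    and "P (restrict K (carrier V))"
    and "\<And>f x s. graded_linear V W f \<Longrightarrow> P f \<Longrightarrow> s \<in> T x \<Longrightarrow> f s = K s"
    and "f = the_gmap V W P"
  shows "f \<in> Arr (VectG g) \<and> src f = V \<and> tgt f = W \<and> P (ap f)"
proof -
  have f: "f = Arrow V (restrict K (carrier V)) W"
    unfolding assms(8) by (rule the_gmap_eq[of V W T K P]) (fact assms)+
  show ?thesis
    using graded_linear_restrict[OF assms(1-5)] assms(1,2,6)
    by (simp add: f in_Arr_iff del: Arr_graded)
qed

lemma ex_arrow:
  assumes "graded_space V" "graded_space W" "generates T V" "vlinear K"
    and "\<And>x s. s \<in> T x \<Longrightarrow> K s \<in> W x"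
  shows "\<exists>f\<in>Arr (VectG g). src f = V \<and> tgt f = W \<and> (\<forall>v\<in>carrier V. ap f v = K v)"
  using graded_linear_restrict[OF assms] assms(1,2)
  by (intro bexI[of _ "Arrow V (restrict K (carrier V)) W"]) (simp_all add: in_Arr_iff del: Arr_graded)

lemma Ident_simps [simp]:
  "src (Ident (VectG g) V) = V" "tgt (Ident (VectG g) V) = V"
  "v \<in> carrier V \<Longrightarrow> ap (Ident (VectG g) V) v = v"
  by (simp_all add: VectG_def)

lemma Ident_Arr [simp]: "graded_space V \<Longrightarrow> Ident (VectG g) V \<in> Arr (VectG g)"
  using graded_linear_restrict[OF _ _ generates_self vlinear_id, of V V]
  by (simp add: in_Arr_iff del: Arr_graded) (simp add: VectG_def)

lemma Comp_simps [simp]: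
  "src (Comp (VectG g) h f) = src f" "tgt (Comp (VectG g) h f) = tgt h"
  "v \<in> carrier (src f) \<Longrightarrow> ap (Comp (VectG g) h f) v = ap h (ap f v)"
  by (simp_all add: VectG_def compose_def)

lemma Comp_Arr [simp]:
  assumes "f \<in> Arr (VectG g)" "h \<in> Arr (VectG g)" "src h = tgt f"
  shows "Comp (VectG g) h f \<in> Arr (VectG g)"
proof -
  have "graded_linear (src f) (tgt h) (ap (Comp (VectG g) h f))"
    unfolding graded_linear_def
  proof (intro conjI ballI allI)
    show "ap (Comp (VectG g) h f) \<in> extensional (carrier (src f))"
      by (simp add: VectG_def)
    show "ap (Comp (VectG g) h f) ` src f x \<subseteq> tgt h x" for x
      using assms homogeneous_carrier[of "src f"] by auto
  qed (use assms subspace_carrier[of "src f"] in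
    \<open>simp_all add: ap_add vec.subspace_add vec.subspace_scale\<close>)
  then show ?thesis using assms unfolding in_Arr_iff by simp
qed

lemma TensA_spec:
  assumes "f \<in> Arr (VectG g)" "h \<in> Arr (VectG g)"
  shows "TensA (VectG g) f h \<in> Arr (VectG g)"
    "src (TensA (VectG g) f h) = gtens (src f) (src h)"
    "tgt (TensA (VectG g) f h) = gtens (tgt f) (tgt h)"
    "\<forall>v\<in>carrier (src f). \<forall>w\<in>carrier (src h). ap (TensA (VectG g) f h) (v \<odot> w) = ap f v \<odot> ap h w"
proof -
  obtain F H where F: "vlinear F" "\<forall>v\<in>carrier (src f). F v = ap f v"
      and H: "vlinear H" "\<forall>v\<in>carrier (src h). H v = ap h v"
    using assms graded_linear_extend unfolding in_Arr_iff by metis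
  let ?K = "bilift (\<lambda>v w. F v \<odot> H w)"
  note c = homogeneous_carrier[OF Arr_graded(1)[OF assms(1)]]
    homogeneous_carrier[OF Arr_graded(1)[OF assms(2)]]
  have K: "?K (v \<odot> w) = ap f v \<odot> ap h w" if "v \<in> carrier (src f)" "w \<in> carrier (src h)" for v w
    using that F H by (simp add: bilift_vtens vbilinear_vtens_compose)
  have Ktw: "?K (tw x y v w) = tw x y (ap f v) (ap h w)" if "v \<in> src f x" "w \<in> src h y" for v w x y
    using K[of v w] c that by (simp add: tw_def vlinear_smul vlinear_bilift)
  have 1: "graded_space (gtens (src f) (src h))" "graded_space (gtens (tgt f) (tgt h))"
    "graded_space (src f)" "graded_space (src h)"
    using assms by auto
  have 2: "?K s \<in> gtens (tgt f) (tgt h) x" if "s \<in> tw_set (src f) (src h) x" for x s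
    using that assms by (auto simp: tw_set_def Ktw)
  have 3: "\<forall>v\<in>carrier (src f). \<forall>w\<in>carrier (src h).
      restrict ?K (carrier (gtens (src f) (src h))) (v \<odot> w) = ap f v \<odot> ap h w"
    using 1 K by (simp add: vtens_carrier)
  have 4: "k s = ?K s" if "graded_linear (gtens (src f) (src h)) (gtens (tgt f) (tgt h)) k"
    "\<forall>v\<in>carrier (src f). \<forall>w\<in>carrier (src h). k (v \<odot> w) = ap f v \<odot> ap h w"
    "s \<in> tw_set (src f) (src h) x" for k x s
  proof -
    obtain a b v w where s: "s = tw a b v w" "v \<in> src f a" "w \<in> src h b"
      using \<open>s \<in> _\<close> unfolding tw_set_def by blast
    then have "k s = g a b *\<^sub>k k (v \<odot> w)"
      using that(1) c 1 vtens_carrier[of "src f" "src h" v w] unfolding graded_linear_def tw_def by simp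
    then show ?thesis using s c that(2) Ktw by (simp add: tw_def)
  qed
  have "TensA (VectG g) f h \<in> Arr (VectG g) \<and> src (TensA (VectG g) f h) = gtens (src f) (src h) \<and>
      tgt (TensA (VectG g) f h) = gtens (tgt f) (tgt h) \<and>
      (\<forall>v\<in>carrier (src f). \<forall>w\<in>carrier (src h). ap (TensA (VectG g) f h) (v \<odot> w) = ap f v \<odot> ap h w)"
  proof (rule the_gmap_arrow[where T = "tw_set (src f) (src h)" and K = ?K and
        P = "\<lambda>k. \<forall>v\<in>carrier (src f). \<forall>w\<in>carrier (src h). k (v \<odot> w) = ap f v \<odot> ap h w"])
    show "generates (tw_set (src f) (src h)) (gtens (src f) (src h))"
      using 1 by (intro generates_gtens generates_self)
    show "TensA (VectG g) f h = the_gmap (gtens (src f) (src h)) (gtens (tgt f) (tgt h))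
       (\<lambda>k. \<forall>v\<in>carrier (src f). \<forall>w\<in>carrier (src h). k (v \<odot> w) = ap f v \<odot> ap h w)"
      by (simp add: VectG_def)
  qed (fact 1 2 3 4 vlinear_bilift)+
  then show "TensA (VectG g) f h \<in> Arr (VectG g)"
    "src (TensA (VectG g) f h) = gtens (src f) (src h)"
    "tgt (TensA (VectG g) f h) = gtens (tgt f) (tgt h)"
    "\<forall>v\<in>carrier (src f). \<forall>w\<in>carrier (src h). ap (TensA (VectG g) f h) (v \<odot> w) = ap f v \<odot> ap h w"
    by blast+
qed

lemma TensA_simps [simp]:
  assumes "f \<in> Arr (VectG g)" "h \<in> Arr (VectG g)"
  shows "TensA (VectG g) f h \<in> Arr (VectG g)"
    "src (TensA (VectG g) f h) = gtens (src f) (src h)"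
    "tgt (TensA (VectG g) f h) = gtens (tgt f) (tgt h)"
    "v \<in> carrier (src f) \<Longrightarrow> w \<in> carrier (src h) \<Longrightarrow>
      ap (TensA (VectG g) f h) (tw x y v w) = tw x y (ap f v) (ap h w)"
  using TensA_spec[OF assms] assms by (simp_all add: tw_def vtens_carrier)

section \<open>The constraints on twisted tensors\<close>

lemma graded_linear_smul:
  "graded_linear V W k \<Longrightarrow> v \<in> carrier V \<Longrightarrow> k (c *\<^sub>k v) = c *\<^sub>k k v"
  by (simp add: graded_linear_def)

lemma Braid_simps [simp]:
  assumes VW: "graded_space V" "graded_space W"
  shows "Braid (VectG g) V W \<in> Arr (VectG g)"
    "src (Braid (VectG g) V W) = gtens V W" "tgt (Braid (VectG g) V W) = gtens W V"
    "v \<in> V x \<Longrightarrow> w \<in> W y \<Longrightarrow> ap (Braid (VectG g) V W) (tw x y v w) = tw y x w v"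
proof -
  let ?P = "\<lambda>k. \<forall>x y. \<forall>v\<in>V x. \<forall>w\<in>W y. k (v \<odot> w) = (inverse (g x y) * g y x) *\<^sub>k (w \<odot> v)"
  obtain K where K: "vlinear K" "?P K"
    using ex_exchange[OF VW, of "\<lambda>x y. inverse (g x y) * g y x"] by blast
  have in_carrier: "v \<odot> w \<in> carrier (gtens V W)" if "v \<in> V x" "w \<in> W y" for v w x y
    using that VW by (simp add: vtens_carrier homogeneous_carrier)
  have on_tw: "k (tw x y v w) = tw y x w v"
    if "?P k" "\<And>c s. s \<in> carrier (gtens V W) \<Longrightarrow> k (c *\<^sub>k s) = c *\<^sub>k k s" "v \<in> V x" "w \<in> W y"
    for k v w x y
    using that in_carrier[OF that(3,4)] by (simp add: tw_def)
  have K_tw: "K (tw x y v w) = tw y x w v" if "v \<in> V x" "w \<in> W y" for v w x y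
    using on_tw[OF K(2) _ that] K(1) by (simp add: vlinear_smul)
  have "Braid (VectG g) V W \<in> Arr (VectG g) \<and> src (Braid (VectG g) V W) = gtens V W \<and>
    tgt (Braid (VectG g) V W) = gtens W V \<and> ?P (ap (Braid (VectG g) V W))"
  proof (rule the_gmap_arrow[where P = ?P and T = "tw_set V W" and K = K])
    show "generates (tw_set V W) (gtens V W)"
      by (intro generates_gtens generates_self VW)
    show "K s \<in> gtens W V x" if "s \<in> tw_set V W x" for s x
      using that by (auto simp: tw_set_def K_tw mult.commute)
    show "?P (restrict K (carrier (gtens V W)))"
      using K(2) in_carrier by simp
    show "k s = K s" if k: "graded_linear (gtens V W) (gtens W V) k" "?P k" "s \<in> tw_set V W x" for k s x
    proof -
      obtain a b v w where s: "s = tw a b v w" "v \<in> V a" "w \<in> W b"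
        using k(3) unfolding tw_set_def by blast
      show ?thesis
        unfolding s(1) K_tw[OF s(2,3)] by (rule on_tw[OF k(2) graded_linear_smul[OF k(1)] s(2,3)])
    qed
    show "Braid (VectG g) V W = the_gmap (gtens V W) (gtens W V) ?P"
      by (simp add: VectG_def)
  qed (use VW K in simp_all)
  then have *: "Braid (VectG g) V W \<in> Arr (VectG g)" "src (Braid (VectG g) V W) = gtens V W"
    "tgt (Braid (VectG g) V W) = gtens W V" "?P (ap (Braid (VectG g) V W))"
    by blast+
  then show "Braid (VectG g) V W \<in> Arr (VectG g)"
    "src (Braid (VectG g) V W) = gtens V W" "tgt (Braid (VectG g) V W) = gtens W V"
    by blast+
  show "ap (Braid (VectG g) V W) (tw x y v w) = tw y x w v" if "v \<in> V x" "w \<in> W y"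
    using that * by (intro on_tw) simp_all
qed

text \<open>
  This is where \<open>assoc_coeff g\<close> being the coboundary of \<open>g\<close> enters: the four values of \<open>g\<close> in it
  cancel against those hidden in the twisted tensors on both sides. The premise \<open>p = x * y\<close> lets
  the simplifier apply the rule to degrees in any normal form.
\<close>

lemma Assoc_simps [simp]:
  assumes VWZ: "graded_space V" "graded_space W" "graded_space Z"
  shows "Assoc (VectG g) V W Z \<in> Arr (VectG g)"
    "src (Assoc (VectG g) V W Z) = gtens (gtens V W) Z"
    "tgt (Assoc (VectG g) V W Z) = gtens V (gtens W Z)"
    "p = x * y \<Longrightarrow> v \<in> V x \<Longrightarrow> w \<in> W y \<Longrightarrow> u \<in> Z z \<Longrightarrow>
      ap (Assoc (VectG g) V W Z) (tw p z (tw x y v w) u) = tw x (y * z) v (tw y z w u)"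
proof -
  let ?P = "\<lambda>k. \<forall>x y z. \<forall>v\<in>V x. \<forall>w\<in>W y. \<forall>u\<in>Z z.
    k ((v \<odot> w) \<odot> u) = assoc_coeff g x y z *\<^sub>k (v \<odot> (w \<odot> u))"
  obtain K where K: "vlinear K" "?P K"
    using ex_reassociation[OF VWZ, of "assoc_coeff g"] by blast
  have in_carrier: "(v \<odot> w) \<odot> u \<in> carrier (gtens (gtens V W) Z)"
    if "v \<in> V x" "w \<in> W y" "u \<in> Z z" for v w u x y z
    using that VWZ by (simp add: vtens_carrier homogeneous_carrier)
  have on_tw: "k (tw (x * y) z (tw x y v w) u) = tw x (y * z) v (tw y z w u)"
    if "?P k" "\<And>c s. s \<in> carrier (gtens (gtens V W) Z) \<Longrightarrow> k (c *\<^sub>k s) = c *\<^sub>k k s"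
      "v \<in> V x" "w \<in> W y" "u \<in> Z z"
    for k v w u x y z
  proof -
    have "k ((v \<odot> w) \<odot> u) = assoc_coeff g x y z *\<^sub>k (v \<odot> (w \<odot> u))"
      using that by blast
    then show ?thesis
      using that(2) in_carrier[OF that(3-5)] by (simp add: tw_def assoc_coeff_def field_simps)
  qed
  have K_tw: "K (tw (x * y) z (tw x y v w) u) = tw x (y * z) v (tw y z w u)"
    if "v \<in> V x" "w \<in> W y" "u \<in> Z z" for v w u x y z
    using on_tw[OF K(2) _ that] K(1) by (simp add: vlinear_smul)
  have "Assoc (VectG g) V W Z \<in> Arr (VectG g) \<and>
    src (Assoc (VectG g) V W Z) = gtens (gtens V W) Z \<and>
    tgt (Assoc (VectG g) V W Z) = gtens V (gtens W Z) \<and> ?P (ap (Assoc (VectG g) V W Z))"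
  proof (rule the_gmap_arrow[where P = ?P and T = "tw_set (tw_set V W) Z" and K = K])
    show "generates (tw_set (tw_set V W) Z) (gtens (gtens V W) Z)"
      by (intro generates_gtens generates_self VWZ)
    show "K s \<in> gtens V (gtens W Z) x" if "s \<in> tw_set (tw_set V W) Z x" for s x
      using that by (auto simp: tw_set_def K_tw mult.assoc)
    show "?P (restrict K (carrier (gtens (gtens V W) Z)))"
      using K(2) in_carrier by simp
    show "k s = K s" if k: "graded_linear (gtens (gtens V W) Z) (gtens V (gtens W Z)) k" "?P k"
      "s \<in> tw_set (tw_set V W) Z x" for k s x
    proof -
      obtain a b d v w u where s: "s = tw (a * b) d (tw a b v w) u" "v \<in> V a" "w \<in> W b" "u \<in> Z d"
        using k(3) unfolding tw_set_def by blast
      show ?thesis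
        unfolding s(1) K_tw[OF s(2-4)] by (rule on_tw[OF k(2) graded_linear_smul[OF k(1)] s(2-4)])
    qed
    show "Assoc (VectG g) V W Z = the_gmap (gtens (gtens V W) Z) (gtens V (gtens W Z)) ?P"
      by (simp add: VectG_def)
  qed (use VWZ K in simp_all)
  then have *: "Assoc (VectG g) V W Z \<in> Arr (VectG g)"
    "src (Assoc (VectG g) V W Z) = gtens (gtens V W) Z"
    "tgt (Assoc (VectG g) V W Z) = gtens V (gtens W Z)" "?P (ap (Assoc (VectG g) V W Z))"
    by blast+
  then show "Assoc (VectG g) V W Z \<in> Arr (VectG g)"
    "src (Assoc (VectG g) V W Z) = gtens (gtens V W) Z"
    "tgt (Assoc (VectG g) V W Z) = gtens V (gtens W Z)"
    by blast+
  show "ap (Assoc (VectG g) V W Z) (tw p z (tw x y v w) u) = tw x (y * z) v (tw y z w u)"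
    if "p = x * y" "v \<in> V x" "w \<in> W y" "u \<in> Z z"
    unfolding that(1) using that(2-4) * by (intro on_tw) simp_all
qed

text \<open>
  The coefficient of \<open>IUnit\<close> identifies the unit object with the field. The unit object is
  generated by the single vector \<open>unit_vec\<close>.
\<close>

lemma LUnit_simps [simp]:
  fixes V :: "('b, 'k) gspace"
  assumes V: "graded_space V"
  shows "LUnit (VectG g) V \<in> Arr (VectG g)"
    "src (LUnit (VectG g) V) = gtens gunit V" "tgt (LUnit (VectG g) V) = V"
    "v \<in> carrier V \<Longrightarrow> ap (LUnit (VectG g) V) (unit_vec \<odot> v) = v"
proof -
  let ?P = "\<lambda>k. \<forall>v\<in>carrier V. k (unit_vec \<odot> v) = v"
  let ?K = "bilift (\<lambda>s v. Poly_Mapping.lookup s IUnit *\<^sub>k v) :: ('b, 'k) vec \<Rightarrow> ('b, 'k) vec"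
  let ?T = "tw_set (\<lambda>x. if x = e then {unit_vec} else {}) V"
  have bil: "vbilinear (\<lambda>(s :: ('b, 'k) vec) (v :: ('b, 'k) vec). Poly_Mapping.lookup s IUnit *\<^sub>k v)"
    by (simp add: vbilinear_def vlinear_lookup_smul vlinear_compose_smul vlinear_id)
  have K: "?K (unit_vec \<odot> v) = v" for v
    unfolding bilift_vtens[OF bil] by (simp add: unit_vec_def)
  have in_carrier: "unit_vec \<odot> v \<in> carrier (gtens gunit V)" if "v \<in> carrier V" for v
    using that V by (simp add: vtens_carrier)
  have T: "\<exists>v\<in>V x. s = g e x *\<^sub>k (unit_vec \<odot> v)" if "s \<in> ?T x" for s x
    using that by (auto simp: tw_set_def tw_def split: if_splits)
  have "LUnit (VectG g) V \<in> Arr (VectG g) \<and> src (LUnit (VectG g) V) = gtens gunit V \<and>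
    tgt (LUnit (VectG g) V) = V \<and> ?P (ap (LUnit (VectG g) V))"
  proof (rule the_gmap_arrow[where P = ?P and T = ?T and K = ?K])
    show "generates ?T (gtens gunit V)"
      by (intro generates_gtens generates_self generates_gunit V)
    show "?K s \<in> V x" if "s \<in> ?T x" for s x
      using T[OF that] V by (auto simp: vlinear_smul[OF vlinear_bilift] K)
    show "?P (restrict ?K (carrier (gtens gunit V)))"
      using K in_carrier by simp
    show "k s = ?K s" if k: "graded_linear (gtens gunit V) V k" "?P k" "s \<in> ?T x" for k s x
      using T[OF k(3)] k(2) in_carrier homogeneous_carrier[OF V]
      by (auto simp: vlinear_smul[OF vlinear_bilift] K graded_linear_smul[OF k(1)])
    show "LUnit (VectG g) V = the_gmap (gtens gunit V) V ?P"
      by (simp add: VectG_def)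
  qed (use V vlinear_bilift in simp_all)
  then show "LUnit (VectG g) V \<in> Arr (VectG g)"
    "src (LUnit (VectG g) V) = gtens gunit V" "tgt (LUnit (VectG g) V) = V"
    "v \<in> carrier V \<Longrightarrow> ap (LUnit (VectG g) V) (unit_vec \<odot> v) = v"
    by blast+
qed

lemma RUnit_simps [simp]:
  fixes V :: "('b, 'k) gspace"
  assumes V: "graded_space V"
  shows "RUnit (VectG g) V \<in> Arr (VectG g)"
    "src (RUnit (VectG g) V) = gtens V gunit" "tgt (RUnit (VectG g) V) = V"
    "v \<in> carrier V \<Longrightarrow> ap (RUnit (VectG g) V) (v \<odot> unit_vec) = v"
proof -
  let ?P = "\<lambda>k. \<forall>v\<in>carrier V. k (v \<odot> unit_vec) = v"
  let ?K = "bilift (\<lambda>v s. Poly_Mapping.lookup s IUnit *\<^sub>k v) :: ('b, 'k) vec \<Rightarrow> ('b, 'k) vec"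
  let ?T = "tw_set V (\<lambda>x. if x = e then {unit_vec} else {})"
  have bil: "vbilinear (\<lambda>(v :: ('b, 'k) vec) (s :: ('b, 'k) vec). Poly_Mapping.lookup s IUnit *\<^sub>k v)"
    by (simp add: vbilinear_def vlinear_lookup_smul vlinear_compose_smul vlinear_id)
  have K: "?K (v \<odot> unit_vec) = v" for v
    unfolding bilift_vtens[OF bil] by (simp add: unit_vec_def)
  have in_carrier: "v \<odot> unit_vec \<in> carrier (gtens V gunit)" if "v \<in> carrier V" for v
    using that V by (simp add: vtens_carrier)
  have T: "\<exists>v\<in>V x. s = g x e *\<^sub>k (v \<odot> unit_vec)" if "s \<in> ?T x" for s x
    using that by (auto simp: tw_set_def tw_def split: if_splits)
  have "RUnit (VectG g) V \<in> Arr (VectG g) \<and> src (RUnit (VectG g) V) = gtens V gunit \<and>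
    tgt (RUnit (VectG g) V) = V \<and> ?P (ap (RUnit (VectG g) V))"
  proof (rule the_gmap_arrow[where P = ?P and T = ?T and K = ?K])
    show "generates ?T (gtens V gunit)"
      by (intro generates_gtens generates_self generates_gunit V)
    show "?K s \<in> V x" if "s \<in> ?T x" for s x
      using T[OF that] V by (auto simp: vlinear_smul[OF vlinear_bilift] K)
    show "?P (restrict ?K (carrier (gtens V gunit)))"
      using K in_carrier by simp
    show "k s = ?K s" if k: "graded_linear (gtens V gunit) V k" "?P k" "s \<in> ?T x" for k s x
      using T[OF k(3)] k(2) in_carrier homogeneous_carrier[OF V]
      by (auto simp: vlinear_smul[OF vlinear_bilift] K graded_linear_smul[OF k(1)])
    show "RUnit (VectG g) V = the_gmap (gtens V gunit) V ?P"
      by (simp add: VectG_def)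
  qed (use V vlinear_bilift in simp_all)
  then show "RUnit (VectG g) V \<in> Arr (VectG g)"
    "src (RUnit (VectG g) V) = gtens V gunit" "tgt (RUnit (VectG g) V) = V"
    "v \<in> carrier V \<Longrightarrow> ap (RUnit (VectG g) V) (v \<odot> unit_vec) = v"
    by blast+
qed

text \<open>
  The unit constraints are not twisted, so they are the only ones in which \<open>g\<close> remains visible.
\<close>

lemma unit_tw [simp]:
  assumes "graded_space V" "v \<in> carrier V"
  shows "ap (LUnit (VectG g) V) (tw x y unit_vec v) = g x y *\<^sub>k v"
    and "ap (RUnit (VectG g) V) (tw x y v unit_vec) = g x y *\<^sub>k v"
  using assms by (simp_all add: tw_def vtens_carrier)

section \<open>The symmetric monoidal category\<close>

lemma is_inverseI:
  assumes "f \<in> Arr (VectG g)" "h \<in> Arr (VectG g)" "src h = tgt f" "tgt h = src f"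
    and T: "generates T (src f)" "\<And>x s. s \<in> T x \<Longrightarrow> ap h (ap f s) = s"
    and U: "generates U (tgt f)" "\<And>x u. u \<in> U x \<Longrightarrow> ap f (ap h u) = u"
  shows "is_inverse (VectG g) f h"
proof -
  have "Comp (VectG g) h f = Ident (VectG g) (src f)"
    using assms(1-4) T homogeneous_carrier[OF Arr_graded(1)[OF assms(1)] generates_in[OF T(1)]]
    by (intro arrow_eqI[OF _ _ _ _ _ T(1)]) simp_all
  moreover have "Comp (VectG g) f h = Ident (VectG g) (tgt f)"
    using assms(1-4) U homogeneous_carrier[OF Arr_graded(2)[OF assms(1)] generates_in[OF U(1)]]
    by (intro arrow_eqI[OF _ _ _ _ _ U(1)]) simp_all
  ultimately show ?thesis
    using assms(1-4) by (simp add: is_inverse_def in_Hom_iff)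
qed

lemma Inv_eq:
  assumes "f \<in> Arr (VectG g)" "is_inverse (VectG g) f h"
  shows "Inv (VectG g) f = h"
  unfolding Inv_def
proof (rule the_equality)
  fix h' assume h': "is_inverse (VectG g) f h'"
  note d = assms(2) h' assms(1)
  have arr: "h \<in> Arr (VectG g)" "src h = tgt f" "tgt h = src f"
      "h' \<in> Arr (VectG g)" "src h' = tgt f" "tgt h' = src f"
    using d by (simp_all add: is_inverse_def in_Hom_iff)
  have id: "Comp (VectG g) h f = Ident (VectG g) (src f)" "Comp (VectG g) f h' = Ident (VectG g) (tgt f)"
    using d by (simp_all add: is_inverse_def)
  show "h' = h"
  proof (rule arrow_eqI[OF arr(4,1,5,2) _ generates_self])
    fix x v assume "v \<in> tgt f x"
    then have v: "v \<in> carrier (tgt f)" using assms(1) by (simp add: homogeneous_carrier)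
    then have "ap h (ap f (ap h' v)) = ap h' v"
      using arg_cong[OF id(1), of "\<lambda>k. ap k (ap h' v)"] arr assms(1) by simp
    moreover have "ap f (ap h' v) = v"
      using arg_cong[OF id(2), of "\<lambda>k. ap k v"] arr assms(1) v by simp
    ultimately show "ap h' v = ap h v" by simp
  qed (use arr assms(1) in simp_all)
qed (rule assms(2))

lemma Assoc_inverse:
  assumes VWZ: "graded_space V" "graded_space W" "graded_space Z"
  shows "is_inverse (VectG g) (Assoc (VectG g) V W Z) (Inv (VectG g) (Assoc (VectG g) V W Z))"
    and "q = y * z \<Longrightarrow> v \<in> V x \<Longrightarrow> w \<in> W y \<Longrightarrow> u \<in> Z z \<Longrightarrow>
      ap (Inv (VectG g) (Assoc (VectG g) V W Z)) (tw x q v (tw y z w u)) = tw (x * y) z (tw x y v w) u"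
proof -
  note self = VWZ[THEN generates_self]
  note gens = generates_gtens[OF self(1) generates_gtens[OF self(2,3)]]
    generates_gtens[OF generates_gtens[OF self(1,2)] self(3)]
  obtain K where K: "vlinear K" "\<And>x y z v w u. v \<in> V x \<Longrightarrow> w \<in> W y \<Longrightarrow> u \<in> Z z \<Longrightarrow>
      K (v \<odot> (w \<odot> u)) = inverse (assoc_coeff g x y z) *\<^sub>k ((v \<odot> w) \<odot> u)"
    using ex_inverse_reassociation[OF VWZ, of "\<lambda>x y z. inverse (assoc_coeff g x y z)"] by blast
  have K_tw: "K (tw x (y * z) v (tw y z w u)) = tw (x * y) z (tw x y v w) u"
    if "v \<in> V x" "w \<in> W y" "u \<in> Z z" for v w u x y z
    using K(2)[OF that] by (simp add: tw_def assoc_coeff_def vlinear_smul[OF K(1)] field_simps)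
  obtain h where h: "h \<in> Arr (VectG g)" "src h = gtens V (gtens W Z)" "tgt h = gtens (gtens V W) Z"
    "\<And>s. s \<in> carrier (gtens V (gtens W Z)) \<Longrightarrow> ap h s = K s"
  proof -
    have "\<exists>f\<in>Arr (VectG g). src f = gtens V (gtens W Z) \<and> tgt f = gtens (gtens V W) Z \<and>
        (\<forall>v\<in>carrier (gtens V (gtens W Z)). ap f v = K v)"
    proof (rule ex_arrow[OF _ _ gens(1) K(1)])
      show "K s \<in> gtens (gtens V W) Z x" if "s \<in> tw_set V (tw_set W Z) x" for s x
        using that by (auto simp: tw_set_def K_tw mult.assoc)
    qed (use VWZ in simp_all)
    then show ?thesis using that by blast
  qed
  have h_tw: "ap h (tw x (y * z) v (tw y z w u)) = tw (x * y) z (tw x y v w) u"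
    if "v \<in> V x" "w \<in> W y" "u \<in> Z z" for v w u x y z
    using that VWZ K_tw h by (simp add: homogeneous_carrier)
  have inv: "is_inverse (VectG g) (Assoc (VectG g) V W Z) h"
  proof (rule is_inverseI)
    show "generates (tw_set V (tw_set W Z)) (tgt (Assoc (VectG g) V W Z))"
      "generates (tw_set (tw_set V W) Z) (src (Assoc (VectG g) V W Z))"
      using gens VWZ by simp_all
  qed (use VWZ h(1-3) h_tw in \<open>auto simp: tw_set_def\<close>)
  have eq: "Inv (VectG g) (Assoc (VectG g) V W Z) = h"
    using inv VWZ by (intro Inv_eq) simp_all
  show "is_inverse (VectG g) (Assoc (VectG g) V W Z) (Inv (VectG g) (Assoc (VectG g) V W Z))"
    using inv by (simp add: eq)
  show "ap (Inv (VectG g) (Assoc (VectG g) V W Z)) (tw x q v (tw y z w u)) = tw (x * y) z (tw x y v w) u"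
    if "q = y * z" "v \<in> V x" "w \<in> W y" "u \<in> Z z"
    using h_tw[OF that(2-4)] by (simp add: eq that(1))
qed

lemma LUnit_inverse:
  assumes V: "graded_space V"
  shows "is_inverse (VectG g) (LUnit (VectG g) V) (Inv (VectG g) (LUnit (VectG g) V))"
    and "v \<in> carrier V \<Longrightarrow> ap (Inv (VectG g) (LUnit (VectG g) V)) v = unit_vec \<odot> v"
proof -
  obtain h where h: "h \<in> Arr (VectG g)" "src h = V" "tgt h = gtens gunit V"
    "\<And>s. s \<in> carrier V \<Longrightarrow> ap h s = unit_vec \<odot> s"
  proof -
    have "\<exists>f\<in>Arr (VectG g). src f = V \<and> tgt f = gtens gunit V \<and> (\<forall>v\<in>carrier V. ap f v = unit_vec \<odot> v)"
      using V by (intro ex_arrow[OF _ _ generates_self] vlinear_vtens_right vlinear_id)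
        (simp_all add: vtens_in_gtens[of _ gunit e])
    then show ?thesis using that by blast
  qed
  have inv: "is_inverse (VectG g) (LUnit (VectG g) V) h"
  proof (rule is_inverseI)
    show "generates V (tgt (LUnit (VectG g) V))"
      "generates (tw_set (\<lambda>x. if x = e then {unit_vec} else {}) V) (src (LUnit (VectG g) V))"
      using V by (simp_all add: generates_self generates_gtens generates_gunit)
    show "ap h (ap (LUnit (VectG g) V) s) = s"
      if "s \<in> tw_set (\<lambda>x. if x = e then {unit_vec} else {}) V x" for s x
    proof -
      obtain v where "v \<in> V x" "s = tw e x unit_vec v"
        using \<open>s \<in> _\<close> unfolding tw_set_def by (auto split: if_splits)
      moreover from this have "v \<in> carrier V" using V by (simp add: homogeneous_carrier)
      ultimately show ?thesis using V h by simp (simp add: tw_def)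
    qed
  qed (use V h homogeneous_carrier[OF V] in simp_all)
  have eq: "Inv (VectG g) (LUnit (VectG g) V) = h"
    using inv V by (intro Inv_eq) simp_all
  show "is_inverse (VectG g) (LUnit (VectG g) V) (Inv (VectG g) (LUnit (VectG g) V))"
    using inv by (simp add: eq)
  show "v \<in> carrier V \<Longrightarrow> ap (Inv (VectG g) (LUnit (VectG g) V)) v = unit_vec \<odot> v"
    by (simp add: eq h)
qed

lemma RUnit_inverse:
  assumes V: "graded_space V"
  shows "is_inverse (VectG g) (RUnit (VectG g) V) (Inv (VectG g) (RUnit (VectG g) V))"
    and "v \<in> carrier V \<Longrightarrow> ap (Inv (VectG g) (RUnit (VectG g) V)) v = v \<odot> unit_vec"
proof -
  obtain h where h: "h \<in> Arr (VectG g)" "src h = V" "tgt h = gtens V gunit"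
    "\<And>s. s \<in> carrier V \<Longrightarrow> ap h s = s \<odot> unit_vec"
  proof -
    have "\<exists>f\<in>Arr (VectG g). src f = V \<and> tgt f = gtens V gunit \<and> (\<forall>v\<in>carrier V. ap f v = v \<odot> unit_vec)"
      using V by (intro ex_arrow[OF _ _ generates_self] vlinear_vtens_left vlinear_id)
        (simp_all add: vtens_in_gtens[of _ _ _ _ gunit e])
    then show ?thesis using that by blast
  qed
  have inv: "is_inverse (VectG g) (RUnit (VectG g) V) h"
  proof (rule is_inverseI)
    show "generates V (tgt (RUnit (VectG g) V))"
      "generates (tw_set V (\<lambda>x. if x = e then {unit_vec} else {})) (src (RUnit (VectG g) V))"
      using V by (simp_all add: generates_self generates_gtens generates_gunit)
    show "ap h (ap (RUnit (VectG g) V) s) = s"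
      if "s \<in> tw_set V (\<lambda>x. if x = e then {unit_vec} else {}) x" for s x
    proof -
      obtain v where "v \<in> V x" "s = tw x e v unit_vec"
        using \<open>s \<in> _\<close> unfolding tw_set_def by (auto split: if_splits)
      moreover from this have "v \<in> carrier V" using V by (simp add: homogeneous_carrier)
      ultimately show ?thesis using V h by simp (simp add: tw_def)
    qed
  qed (use V h homogeneous_carrier[OF V] in simp_all)
  have eq: "Inv (VectG g) (RUnit (VectG g) V) = h"
    using inv V by (intro Inv_eq) simp_all
  show "is_inverse (VectG g) (RUnit (VectG g) V) (Inv (VectG g) (RUnit (VectG g) V))"
    using inv by (simp add: eq)
  show "v \<in> carrier V \<Longrightarrow> ap (Inv (VectG g) (RUnit (VectG g) V)) v = v \<odot> unit_vec"
    by (simp add: eq h)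
qed

lemma is_isoI: "f \<in> Arr (VectG g) \<Longrightarrow> is_inverse (VectG g) f h \<Longrightarrow> is_iso (VectG g) f"
  unfolding is_iso_def by blast

lemma Inv_simps [simp]:
  assumes "is_inverse (VectG g) f (Inv (VectG g) f)"
  shows "Inv (VectG g) f \<in> Arr (VectG g)" "src (Inv (VectG g) f) = tgt f" "tgt (Inv (VectG g) f) = src f"
  using assms by (simp_all add: is_inverse_def in_Hom_iff)

declare Assoc_inverse [simp] LUnit_inverse [simp] RUnit_inverse [simp]

text \<open>
  The equations for the sources come first, so that the simplifier determines \<open>A\<close> and \<open>B\<close> from
  the two arrows before the generating families are chosen.
\<close>

lemma tensor2_eqI:
  assumes "src f = gtens A B" "src h = gtens A B" "f \<in> Arr (VectG g)" "h \<in> Arr (VectG g)" "tgt f = tgt h"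
    and "generates S A" "generates T B"
    and "\<And>x y v w. v \<in> S x \<Longrightarrow> w \<in> T y \<Longrightarrow> ap f (tw x y v w) = ap h (tw x y v w)"
  shows "f = h"
  using assms(8)
  by (intro arrow_eqI[OF assms(3,4,1,2,5) generates_gtens[OF assms(6,7)]]) (auto simp: tw_set_def)

lemma tensor3_eqI:
  assumes "src f = gtens (gtens A B) D" "src h = gtens (gtens A B) D"
    and "f \<in> Arr (VectG g)" "h \<in> Arr (VectG g)" "tgt f = tgt h"
    and "generates S A" "generates T B" "generates U D"
    and "\<And>x y z v w u. v \<in> S x \<Longrightarrow> w \<in> T y \<Longrightarrow> u \<in> U z \<Longrightarrow>
      ap f (tw (x * y) z (tw x y v w) u) = ap h (tw (x * y) z (tw x y v w) u)"
  shows "f = h"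
  using assms(9)
  by (intro tensor2_eqI[OF assms(1-5) generates_gtens[OF assms(6,7)] assms(8)]) (auto simp: tw_set_def)

lemma tensor4_eqI:
  assumes "src f = gtens (gtens (gtens A B) D) E" "src h = gtens (gtens (gtens A B) D) E"
    and "f \<in> Arr (VectG g)" "h \<in> Arr (VectG g)" "tgt f = tgt h"
    and "generates S A" "generates T B" "generates U D" "generates R E"
    and "\<And>x y z q v w u t. v \<in> S x \<Longrightarrow> w \<in> T y \<Longrightarrow> u \<in> U z \<Longrightarrow> t \<in> R q \<Longrightarrow>
      ap f (tw (x * y * z) q (tw (x * y) z (tw x y v w) u) t) =
      ap h (tw (x * y * z) q (tw (x * y) z (tw x y v w) u) t)"
  shows "f = h"
  using assms(10)
  by (intro tensor3_eqI[OF assms(1-5) generates_gtens[OF assms(6,7)] assms(8,9)]) (auto simp: tw_set_def)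

text \<open>
  Every equation between arrows holds on twisted tensors of homogeneous vectors, where both sides
  move or map the same factors. Only the triangle depends on the cochain: its two sides carry the
  factors \<open>g e y\<close> and \<open>g x e\<close>.
\<close>

theorem symmetric_monoidal_VectG:
  "symmetric_monoidal_category
    (VectG g :: (('b, 'k) gspace, ('b, 'k) gmap) monoidal_data)"
proof -
  note [simp] = in_Hom_iff homogeneous_carrier
  show ?thesis
    apply unfold_locales
    \<comment> \<open>composition\<close>
    subgoal by simp
    subgoal by simp
    subgoal by simp
    subgoal by simp
    subgoal by (rule arrow_eqI[OF _ _ _ _ _ generates_self]) auto
    subgoal by (rule arrow_eqI[OF _ _ _ _ _ generates_self]) auto
    subgoal by (rule arrow_eqI[OF _ _ _ _ _ generates_self]) auto
    \<comment> \<open>the tensor product as a functor\<close>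
    subgoal by simp
    subgoal by simp
    subgoal by simp
    subgoal by (rule tensor2_eqI, (simp_all)[5], (rule generates_self, simp)+) auto
    subgoal by (rule tensor2_eqI, (simp_all)[5], (rule generates_self, simp)+) auto
    \<comment> \<open>associativity and unit constraints\<close>
    subgoal by simp
    subgoal by (rule is_isoI, simp, rule Assoc_inverse) simp_all
    subgoal by (rule tensor3_eqI, (simp_all)[5], (rule generates_self, simp)+) auto
    subgoal by simp
    subgoal by (rule is_isoI, simp, rule LUnit_inverse) simp_all
    subgoal
      by (rule tensor2_eqI, (simp_all)[5], rule generates_gunit, rule generates_self, simp)
        (auto split: if_splits)
    subgoal by simp
    subgoal by (rule is_isoI, simp, rule RUnit_inverse) simp_all
    subgoal
      by (rule tensor2_eqI, (simp_all)[5], rule generates_self, simp, rule generates_gunit)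
        (auto split: if_splits)
    \<comment> \<open>braiding\<close>
    subgoal by simp
    subgoal by (rule tensor2_eqI, (simp_all)[5], (rule generates_self, simp)+) auto
    subgoal by (rule tensor2_eqI, (simp_all)[5], (rule generates_self, simp)+) auto
    \<comment> \<open>pentagon, triangle and hexagon\<close>
    subgoal by (rule tensor4_eqI, (simp_all)[5], (rule generates_self, simp)+) (auto simp: mult_ac)
    subgoal
      by (rule tensor3_eqI, (simp_all)[5], rule generates_self, simp, rule generates_gunit,
          rule generates_self, simp)
        (auto simp: mult_ac split: if_splits intro: arg_cong2[where f = smul] g_unit)
    subgoal by (rule tensor3_eqI, (simp_all)[5], (rule generates_self, simp)+) (auto simp: mult_ac)
    done
qed

end

section \<open>The group algebra as a weak braided Hopf algebra\<close>

lemma generates_kG: "generates (\<lambda>x. {\<langle>x\<rangle>}) kG"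
  by (simp add: generates_def kG_def)

lemma graded_space_kG [simp]: "graded_space (kG :: ('b, 'k :: field) gspace)"
proof (rule graded_spaceI[of _ "\<lambda>x v. Poly_Mapping.lookup v (IGrp x) *\<^sub>k \<langle>x\<rangle>"])
  fix x y and v :: "('b, 'k :: field) vec"
  assume "v \<in> kG y"
  then show "Poly_Mapping.lookup v (IGrp x) *\<^sub>k \<langle>x\<rangle> = (if x = y then v else 0)"
    by (auto simp: kG_def vec.span_singleton bas_def lookup_single)
qed (simp_all add: kG_def vlinear_lookup_smul)

lemma bas_in_kG [simp]: "\<langle>x\<rangle> \<in> kG x"
  by (simp add: kG_def vec.span_base)

lemma bas_carrier [simp]: "\<langle>x\<rangle> \<in> carrier kG"
  by (rule homogeneous_carrier[of _ _ x]) simp_all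

lemma klein_translate_sum: "(\<Sum>u\<in>UNIV. f (a * u :: klein)) = (\<Sum>u\<in>UNIV. f u)"
  by (rule sum.reindex_bij_witness[of _ "(*) a" "(*) a"]) simp_all

lemma delta_smul_sum: "(\<Sum>u\<in>UNIV. (if (u :: klein) = a then c else 0) *\<^sub>k f u) = c *\<^sub>k f a"
proof -
  have "(\<Sum>u\<in>UNIV. (if u = a then c else 0) *\<^sub>k f u) = (\<Sum>u\<in>UNIV. if u = a then c *\<^sub>k f u else 0)"
    by (intro sum.cong) simp_all
  then show ?thesis by simp
qed

locale normalized_klein_cochain = klein_cochain g for g :: "klein \<Rightarrow> klein \<Rightarrow> 'k :: field" +
  assumes g_normalized: "g e x = 1"
begin

lemma g_unit_eq_1 [simp]: "g e x = 1" "g x e = 1"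
  using g_unit g_normalized by simp_all

lemma unit_vtens:
  "unit_vec \<odot> \<langle>x\<rangle> = tw e x unit_vec \<langle>x\<rangle>" "\<langle>x\<rangle> \<odot> unit_vec = tw x e \<langle>x\<rangle> unit_vec"
  "unit_vec \<odot> unit_vec = tw e e unit_vec unit_vec"
  by (simp_all add: tw_def)

lemma card_klein: "card (UNIV :: klein set) = 4"
  by (simp add: UNIV_klein)

text \<open>
  Evaluated on twisted tensors of basis vectors, each axiom becomes an identity of the group
  algebra with the comultiplication \<open>x \<mapsto> (1/4) \<Sum>u. u (u * x)\<close>.
\<close>

theorem weak_braided_hopf_algebra_kG:
  fixes m \<eta> \<Delta> \<epsilon> :: "('b, 'k) gmap"
  assumes four: "(4 :: 'k) \<noteq> 0"
    and m: "m \<in> Hom (VectG g) (gtens kG kG) kG" "\<And>x y. ap m (tw x y \<langle>x\<rangle> \<langle>y\<rangle>) = \<langle>x * y\<rangle>"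
    and \<eta>: "\<eta> \<in> Hom (VectG g) gunit kG" "ap \<eta> unit_vec = \<langle>e\<rangle>"
    and \<Delta>: "\<Delta> \<in> Hom (VectG g) kG (gtens kG kG)"
      "\<And>x. ap \<Delta> \<langle>x\<rangle> = inverse 4 *\<^sub>k (\<Sum>u\<in>UNIV. tw u (u * x) \<langle>u\<rangle> \<langle>u * x\<rangle>)"
    and \<epsilon>: "\<epsilon> \<in> Hom (VectG g) kG gunit" "\<And>x. ap \<epsilon> \<langle>x\<rangle> = counit x"
  shows "weak_braided_hopf_algebra (VectG g) kG m \<eta> \<Delta> \<epsilon> (Ident (VectG g) kG)"
proof -
  have arr [simp]: "m \<in> Arr (VectG g)" "src m = gtens kG kG" "tgt m = kG"
    "\<eta> \<in> Arr (VectG g)" "src \<eta> = gunit" "tgt \<eta> = kG"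
    "\<Delta> \<in> Arr (VectG g)" "src \<Delta> = kG" "tgt \<Delta> = gtens kG kG"
    "\<epsilon> \<in> Arr (VectG g)" "src \<epsilon> = kG" "tgt \<epsilon> = gunit"
    using m \<eta> \<Delta> \<epsilon> by (simp_all add: in_Hom_iff)
  note [simp] = four m(2) \<eta>(2) \<Delta>(2) unit_vtens in_Hom_iff card_klein
  have m' [simp]: "p = x \<Longrightarrow> q = y \<Longrightarrow> ap m (tw p q \<langle>x\<rangle> \<langle>y\<rangle>) = \<langle>x * y\<rangle>" for p q x y
    by simp
  \<comment> \<open>\<open>ap \<epsilon> \<langle>p\<rangle>\<close> stays unevaluated, so that the constraints see a vector of degree \<open>p\<close>; its value,
      which may be zero, enters only at a unit constraint\<close>
  have counit_left [simp]: "ap (LUnit (VectG g) V) (tw p q (ap \<epsilon> \<langle>p\<rangle>) v) = (if p = e then 4 else 0) *\<^sub>k v"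
    if "graded_space V" "v \<in> carrier V" for p q v V
    using that by (cases p) (simp_all add: \<epsilon>(2))
  have counit_right [simp]: "ap (RUnit (VectG g) V) (tw q p v (ap \<epsilon> \<langle>p\<rangle>)) = (if p = e then 4 else 0) *\<^sub>k v"
    if "graded_space V" "v \<in> carrier V" for p q v V
    using that by (cases p) (simp_all add: \<epsilon>(2))
  note counit_sums = klein_mult_eq_iff delta_smul_sum vec.sum_constant_scale
  \<comment> \<open>the product of \<open>\<Delta> x\<close> and \<open>\<Delta> y\<close> is a double sum over \<open>i\<close> and \<open>u\<close> that depends on \<open>i * u\<close> only\<close>
  have shift: "(\<Sum>u\<in>UNIV. tw (i * u) (x * (y * (i * u))) \<langle>i * u\<rangle> \<langle>x * (y * (i * u))\<rangle>) =
      (\<Sum>u\<in>UNIV. tw u (x * (y * u)) \<langle>u\<rangle> \<langle>x * (y * u)\<rangle> :: ('b, 'k) vec)" for i x y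
    by (rule klein_translate_sum)
  \<comment> \<open>both iterated comultiplications of \<open>x\<close> are the sum of the triples with product \<open>x\<close>\<close>
  have coassoc: "(\<Sum>i\<in>UNIV. c *\<^sub>k (\<Sum>u\<in>UNIV. tw u (x * u) \<langle>u\<rangle> (tw (i * u) (x * i) \<langle>i * u\<rangle> \<langle>x * i\<rangle>))) =
      (\<Sum>u\<in>UNIV. c *\<^sub>k (\<Sum>i\<in>UNIV. tw u (x * u) \<langle>u\<rangle> (tw i (x * (u * i)) \<langle>i\<rangle> \<langle>x * (u * i)\<rangle>))
        :: ('b, 'k) vec)" (is "?l = ?r") for c x
  proof -
    have "?l = (\<Sum>u\<in>UNIV. c *\<^sub>k (\<Sum>i\<in>UNIV. tw u (x * u) \<langle>u\<rangle> (tw (i * u) (x * i) \<langle>i * u\<rangle> \<langle>x * i\<rangle>)))"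
      unfolding vec.scale_sum_right by (rule sum.swap)
    also have "\<dots> = (\<Sum>u\<in>UNIV. c *\<^sub>k (\<Sum>i\<in>UNIV. tw u (x * u) \<langle>u\<rangle>
        (tw (u * i * u) (x * (u * i)) \<langle>u * i * u\<rangle> \<langle>x * (u * i)\<rangle>)))"
      by (intro sum.cong refl arg_cong2[where f = smul] klein_translate_sum[symmetric])
    also have "\<dots> = ?r" by (simp add: mult_ac)
    finally show ?thesis .
  qed
  show ?thesis
    apply (intro weak_braided_hopf_algebra.intro weak_braided_hopf_algebra_axioms.intro
        symmetric_monoidal_VectG)
    \<comment> \<open>the object and the types of the arrows\<close>
    subgoal by simp
    subgoal by simp
    subgoal by simp
    subgoal by simp
    subgoal by simp
    subgoal by simp
    \<comment> \<open>algebra\<close>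
    subgoal by (rule tensor3_eqI, (simp_all)[5], (rule generates_kG)+) (auto simp: mult_ac)
    subgoal
      by (rule tensor2_eqI, (simp_all)[5], rule generates_gunit, rule generates_kG)
        (auto split: if_splits)
    subgoal
      by (rule tensor2_eqI, (simp_all)[5], rule generates_kG, rule generates_gunit)
        (auto split: if_splits)
    \<comment> \<open>coalgebra\<close>
    subgoal by (rule arrow_eqI[OF _ _ _ _ _ generates_kG]) (auto simp: mult_ac coassoc)
    subgoal by (rule arrow_eqI[OF _ _ _ _ _ generates_kG]) (auto simp: mult_ac counit_sums)
    subgoal by (rule arrow_eqI[OF _ _ _ _ _ generates_kG]) (auto simp: mult_ac counit_sums)
    \<comment> \<open>compatibility of comultiplication, counit and unit with the multiplication\<close>
    subgoal
      by (rule tensor2_eqI, (simp_all)[5], (rule generates_kG)+)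
        (auto simp: mult_ac shift vec.sum_constant_scale)
    subgoal by (rule tensor3_eqI, (simp_all)[5], (rule generates_kG)+) (auto simp: mult_ac counit_sums)
    subgoal by (rule tensor3_eqI, (simp_all)[5], (rule generates_kG)+) (auto simp: mult_ac counit_sums)
    subgoal
      by (rule arrow_eqI[OF _ _ _ _ _ generates_gunit]) (auto simp: mult_ac split: if_splits)
    subgoal
      by (rule arrow_eqI[OF _ _ _ _ _ generates_gunit]) (auto simp: mult_ac split: if_splits)
    \<comment> \<open>antipode\<close>
    subgoal by (rule arrow_eqI[OF _ _ _ _ _ generates_kG]) (auto simp: mult_ac counit_sums)
    subgoal by (rule arrow_eqI[OF _ _ _ _ _ generates_kG]) (auto simp: mult_ac counit_sums)
    subgoal
      by (rule arrow_eqI[OF _ _ _ _ _ generates_kG]) (auto simp: mult_ac vec.sum_constant_scale)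
    done
qed

lemma ex_Hom:
  assumes "graded_space V" "graded_space W" "generates T V" "vlinear K"
    and "\<And>x s. s \<in> T x \<Longrightarrow> K s \<in> W x"
  shows "\<exists>f\<in>Hom (VectG g) V W. \<forall>x. \<forall>s\<in>T x. ap f s = K s"
  using ex_arrow[OF assms] assms(1,2) homogeneous_carrier[OF assms(1) generates_in[OF assms(3)]]
  unfolding Bex_def in_Hom_iff by blast

lemma linear_extension_bas: "linear_extension b \<langle>x\<rangle> = b (IGrp x)"
  by (simp add: bas_def)

lemma linear_extension_unit_vec: "linear_extension b unit_vec = b IUnit"
  by (simp add: unit_vec_def)

lemma bas_vtens: "\<langle>x\<rangle> \<odot> \<langle>y\<rangle> = Poly_Mapping.single (IPair (IGrp x) (IGrp y)) (1 :: 'k)"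
  by (simp add: bas_def vtens_def)

text \<open>
  The same structure in untwisted form: the cochain appears inverted in the multiplication and
  directly in the comultiplication.
\<close>

theorem ex_weak_braided_hopf_algebra_kG:
  fixes \<mu> :: "klein \<Rightarrow> klein \<Rightarrow> ('b, 'k) vec" and \<delta> :: "klein \<Rightarrow> ('b, 'k) vec"
  assumes four: "(4 :: 'k) \<noteq> 0"
    and \<mu>: "\<And>x y. \<mu> x y = inverse (g x y) *\<^sub>k \<langle>x * y\<rangle>"
    and \<delta>: "\<And>x. \<delta> x = inverse 4 *\<^sub>k (\<Sum>u\<in>UNIV. g u (u * x) *\<^sub>k (\<langle>u\<rangle> \<odot> \<langle>u * x\<rangle>))"
  shows "\<exists>m \<eta> \<Delta> \<epsilon> S.
    weak_braided_hopf_algebra (VectG g :: (('b, 'k) gspace, ('b, 'k) gmap) monoidal_data) kG m \<eta> \<Delta> \<epsilon> S \<and>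
    commutative_in (VectG g) kG m \<and> cocommutative_in (VectG g) kG \<Delta> \<and>
    (\<forall>x y. ap m (\<langle>x\<rangle> \<odot> \<langle>y\<rangle>) = \<mu> x y) \<and> ap \<eta> unit_vec = \<langle>e\<rangle> \<and>
    (\<forall>x. ap \<Delta> \<langle>x\<rangle> = \<delta> x) \<and> (\<forall>x. ap \<epsilon> \<langle>x\<rangle> = counit x) \<and>
    S = Ident (VectG g) kG"
proof -
  let ?B = "\<lambda>x. {\<langle>x\<rangle> :: ('b, 'k) vec}"
  have \<delta>_tw: "\<delta> x = inverse 4 *\<^sub>k (\<Sum>u\<in>UNIV. tw u (u * x) \<langle>u\<rangle> \<langle>u * x\<rangle>)" for x
    by (simp add: \<delta> tw_def)
  have "\<exists>f\<in>Hom (VectG g) (gtens kG kG) kG. \<forall>x. \<forall>s\<in>tw_set ?B ?B x. ap f s =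
      linear_extension (\<lambda>p. case p of IPair (IGrp x) (IGrp y) \<Rightarrow> inverse (g x y) *\<^sub>k \<langle>x * y\<rangle> | _ \<Rightarrow> 0) s"
    by (intro ex_Hom generates_gtens generates_kG vlinear_linear_extension)
      (auto simp: tw_set_def tw_def bas_vtens vlinear_smul[OF vlinear_linear_extension])
  then obtain m where m: "m \<in> Hom (VectG g) (gtens kG kG) kG" "\<And>x s. s \<in> tw_set ?B ?B x \<Longrightarrow> ap m s =
      linear_extension (\<lambda>p. case p of IPair (IGrp x) (IGrp y) \<Rightarrow> inverse (g x y) *\<^sub>k \<langle>x * y\<rangle> | _ \<Rightarrow> 0) s"
    by blast
  have m_tw: "ap m (tw x y \<langle>x\<rangle> \<langle>y\<rangle>) = \<langle>x * y\<rangle>" for x y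
  proof -
    have "tw x y \<langle>x\<rangle> \<langle>y\<rangle> \<in> tw_set ?B ?B (x * y)" by (auto simp: tw_set_def)
    then show ?thesis
      by (simp add: m(2)) (simp add: tw_def bas_vtens vlinear_smul[OF vlinear_linear_extension])
  qed
  have "\<exists>f\<in>Hom (VectG g) gunit kG. \<forall>x. \<forall>s\<in>(if x = e then {unit_vec} else {}). ap f s =
      linear_extension (\<lambda>_. \<langle>e\<rangle> :: ('b, 'k) vec) s"
    by (intro ex_Hom generates_gunit vlinear_linear_extension) (auto simp: linear_extension_unit_vec split: if_splits)
  then obtain \<eta> where \<eta>: "\<eta> \<in> Hom (VectG g) gunit kG" "ap \<eta> unit_vec = (\<langle>e\<rangle> :: ('b, 'k) vec)"
    by (auto simp: linear_extension_unit_vec split: if_splits)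
  have "\<exists>f\<in>Hom (VectG g) kG (gtens kG kG). \<forall>x. \<forall>s\<in>?B x. ap f s =
      linear_extension (\<lambda>p. case p of IGrp x \<Rightarrow> \<delta> x | _ \<Rightarrow> 0) s"
    by (intro ex_Hom generates_kG vlinear_linear_extension) (auto simp: linear_extension_bas \<delta>_tw)
  then obtain \<Delta> where \<Delta>: "\<Delta> \<in> Hom (VectG g) kG (gtens kG kG)" "\<And>x. ap \<Delta> \<langle>x\<rangle> = \<delta> x"
    by (auto simp: linear_extension_bas)
  have "\<exists>f\<in>Hom (VectG g) kG gunit. \<forall>x. \<forall>s\<in>?B x. ap f s =
      linear_extension (\<lambda>p. case p of IGrp x \<Rightarrow> (counit x :: ('b, 'k) vec) | _ \<Rightarrow> 0) s"
  proof (intro ex_Hom generates_kG vlinear_linear_extension)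
    show "linear_extension (\<lambda>p. case p of IGrp x \<Rightarrow> (counit x :: ('b, 'k) vec) | _ \<Rightarrow> 0) s \<in> gunit x" if "s \<in> ?B x" for s x
      using that vec.subspace_0[OF graded_spaceD[OF graded_space_gunit]] by (cases x) (auto simp: linear_extension_bas)
  qed simp_all
  then obtain \<epsilon> where \<epsilon>: "\<epsilon> \<in> Hom (VectG g) kG gunit" "\<And>x. ap \<epsilon> \<langle>x\<rangle> = (counit x :: ('b, 'k) vec)"
    by (auto simp: linear_extension_bas)
  have hopf: "weak_braided_hopf_algebra (VectG g) kG m \<eta> \<Delta> \<epsilon> (Ident (VectG g) kG)"
    using m(1) m_tw \<eta> \<Delta> \<epsilon> by (intro weak_braided_hopf_algebra_kG four) (simp_all add: \<delta>_tw)
  note arrows = m(1)[unfolded in_Hom_iff] \<Delta>(1)[unfolded in_Hom_iff]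
  have "commutative_in (VectG g) kG m"
    unfolding commutative_in_def using arrows
    by (intro tensor2_eqI[OF _ _ _ _ _ generates_kG generates_kG]) (auto simp: m_tw mult.commute)
  moreover have "cocommutative_in (VectG g) kG \<Delta>"
    unfolding cocommutative_in_def
  proof (rule arrow_eqI[OF _ _ _ _ _ generates_kG])
    fix x and s :: "('b, 'k) vec" assume "s \<in> ?B x"
    moreover have "(\<Sum>u\<in>UNIV. tw (u * x) u \<langle>u * x\<rangle> \<langle>u\<rangle>) = (\<Sum>u\<in>UNIV. tw u (u * x) \<langle>u\<rangle> \<langle>u * x\<rangle> :: ('b, 'k) vec)"
      using klein_translate_sum[of "\<lambda>u. tw u (u * x) \<langle>u\<rangle> \<langle>u * x\<rangle> :: ('b, 'k) vec" x]
      by (simp add: mult_ac)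
    ultimately show "ap (Comp (VectG g) (Braid (VectG g) kG kG) \<Delta>) s = ap \<Delta> s"
      using arrows by (simp add: \<Delta>(2) \<delta>_tw)
  qed (use arrows in auto)
  moreover have "ap m (\<langle>x\<rangle> \<odot> \<langle>y\<rangle>) = \<mu> x y" for x y
  proof -
    have "\<langle>x\<rangle> \<odot> \<langle>y\<rangle> = inverse (g x y) *\<^sub>k (tw x y \<langle>x\<rangle> \<langle>y\<rangle> :: ('b, 'k) vec)"
      by (simp add: tw_def)
    then show ?thesis using arrows m_tw[of x y] by (simp add: \<mu>)
  qed
  ultimately show ?thesis
    using hopf \<eta>(2) \<Delta>(2) \<epsilon>(2) by blast
qed

end

section \<open>The two cochains\<close>

lemma four_nonzero:
  assumes "CHAR('k :: field) \<noteq> 2"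
  shows "(4 :: 'k) \<noteq> 0"
proof -
  have "\<not> CHAR('k) dvd 2"
  proof
    assume dvd: "CHAR('k) dvd 2"
    then have "CHAR('k) \<le> 2" by (simp add: dvd_imp_le)
    moreover have "CHAR('k) \<noteq> 0" using dvd by (metis dvd_0_left_iff zero_neq_numeral)
    moreover have "CHAR('k) \<noteq> 1" by simp
    ultimately show False using assms by linarith
  qed
  then have "(2 :: 'k) \<noteq> 0"
    by (metis of_nat_eq_0_iff_char_dvd of_nat_numeral)
  moreover have "(4 :: 'k) = 2 * 2" by simp
  ultimately show ?thesis by (metis mult_eq_0_iff)
qed

theorem proposition5p4:
  assumes "CHAR('k :: field) \<noteq> 2"
  shows "(\<forall>a :: 'k. a \<noteq> 0 \<longrightarrow>
      (let C = (VectG (g1 a) :: (('b, 'k) gspace, ('b, 'k) gmap) monoidal_data) in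
       \<exists>m \<eta> \<Delta> \<epsilon> S.
         weak_braided_hopf_algebra C kG m \<eta> \<Delta> \<epsilon> S \<and>
         commutative_in C kG m \<and> cocommutative_in C kG \<Delta> \<and>
         (\<forall>x y. ap m (\<langle>x\<rangle> \<odot> \<langle>y\<rangle>) = mult1 a x y) \<and>
         ap \<eta> unit_vec = \<langle>e\<rangle> \<and>
         (\<forall>x. ap \<Delta> \<langle>x\<rangle> = comult1 a x) \<and>
         (\<forall>x. ap \<epsilon> \<langle>x\<rangle> = counit x) \<and>
         S = Ident C kG)) \<and>
    (\<forall>d :: 'k. d \<noteq> 0 \<longrightarrow>
      (let C = (VectG (g2 d) :: (('b, 'k) gspace, ('b, 'k) gmap) monoidal_data) in
       \<exists>m \<eta> \<Delta> \<epsilon> S.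
         weak_braided_hopf_algebra C kG m \<eta> \<Delta> \<epsilon> S \<and>
         commutative_in C kG m \<and> cocommutative_in C kG \<Delta> \<and>
         (\<forall>x y. ap m (\<langle>x\<rangle> \<odot> \<langle>y\<rangle>) = mult2 d x y) \<and>
         ap \<eta> unit_vec = \<langle>e\<rangle> \<and>
         (\<forall>x. ap \<Delta> \<langle>x\<rangle> = comult2 d x) \<and>
         (\<forall>x. ap \<epsilon> \<langle>x\<rangle> = counit x) \<and>
         S = Ident C kG))"
proof (intro conjI allI impI)
  note four = four_nonzero[OF assms]
  fix a :: 'k assume "a \<noteq> 0"
  then interpret normalized_klein_cochain "g1 a"
    by unfold_locales (simp_all add: g1_def)
  show "let C = (VectG (g1 a) :: (('b, 'k) gspace, ('b, 'k) gmap) monoidal_data) in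
       \<exists>m \<eta> \<Delta> \<epsilon> S.
         weak_braided_hopf_algebra C kG m \<eta> \<Delta> \<epsilon> S \<and>
         commutative_in C kG m \<and> cocommutative_in C kG \<Delta> \<and>
         (\<forall>x y. ap m (\<langle>x\<rangle> \<odot> \<langle>y\<rangle>) = mult1 a x y) \<and>
         ap \<eta> unit_vec = \<langle>e\<rangle> \<and>
         (\<forall>x. ap \<Delta> \<langle>x\<rangle> = comult1 a x) \<and>
         (\<forall>x. ap \<epsilon> \<langle>x\<rangle> = counit x) \<and>
         S = Ident C kG"
    unfolding Let_def
  proof (rule ex_weak_braided_hopf_algebra_kG[OF four])
    show "mult1 a x y = inverse (g1 a x y) *\<^sub>k \<langle>x * y\<rangle>" for x y
      by (cases x; cases y) (simp_all add: g1_def)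
    show "comult1 a x = inverse 4 *\<^sub>k (\<Sum>u\<in>UNIV. g1 a u (u * x) *\<^sub>k (\<langle>u\<rangle> \<odot> \<langle>u * x\<rangle>))" for x
      by (cases x) (simp_all add: g1_def UNIV_klein add_ac)
  qed
next
  note four = four_nonzero[OF assms]
  fix d :: 'k assume "d \<noteq> 0"
  then interpret normalized_klein_cochain "g2 d"
    by unfold_locales (simp_all add: g2_def)
  show "let C = (VectG (g2 d) :: (('b, 'k) gspace, ('b, 'k) gmap) monoidal_data) in
       \<exists>m \<eta> \<Delta> \<epsilon> S.
         weak_braided_hopf_algebra C kG m \<eta> \<Delta> \<epsilon> S \<and>
         commutative_in C kG m \<and> cocommutative_in C kG \<Delta> \<and>
         (\<forall>x y. ap m (\<langle>x\<rangle> \<odot> \<langle>y\<rangle>) = mult2 d x y) \<and>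
         ap \<eta> unit_vec = \<langle>e\<rangle> \<and>
         (\<forall>x. ap \<Delta> \<langle>x\<rangle> = comult2 d x) \<and>
         (\<forall>x. ap \<epsilon> \<langle>x\<rangle> = counit x) \<and>
         S = Ident C kG"
    unfolding Let_def
  proof (rule ex_weak_braided_hopf_algebra_kG[OF four])
    show "mult2 d x y = inverse (g2 d x y) *\<^sub>k \<langle>x * y\<rangle>" for x y
      by (cases x; cases y) (simp_all add: g2_def)
    show "comult2 d x = inverse 4 *\<^sub>k (\<Sum>u\<in>UNIV. g2 d u (u * x) *\<^sub>k (\<langle>u\<rangle> \<odot> \<langle>u * x\<rangle>))" for x
      by (cases x) (simp_all add: g2_def UNIV_klein add_ac)
  qed
qed

end
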